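(* Let $\omega=(\omega_x)_{x\in\mathbb Z}$ be an IID sequence under $\mathbb P$ such that $\mathbb P(\omega_1\in[\alpha,1-\alpha])=1$ for some $\alpha\in(0,1/2)$, $\mathbb E[\log\rho_1]<0$ and $\lambda<\infty$. For integers $1\le k\le N/2$ let $B_{N,k}$ be the event $$t^{N,k,\omega}_{\mathrm{mix}}\ \le\ 80\,kN\,\alpha^{-1}\left(\frac{3u_0+2}{|F(u_0)|}\log N\right)^4 N^{\frac{3u_0+2}{|F(u_0)|}\left(2\log\frac{1-\alpha}{\alpha}+4\log4-3\log3\right)}.$$ Then $B_{N,k}$ holds with high probability, i.e. $\lim_{N\to\infty}\inf_{1\le k\le N/2}\mathbb P[B_{N,k}]=1$.
   Context: Environment: $\rho_x=(1-\omega_x)/\omega_x$; $\lambda=\inf\{s>0:\mathbb E[\rho_1^s]\ge1\}\in(0,\infty]$; $F(u)=\log\mathbb E[\rho_1^u]$ for $u\in\mathbb R$; $u_0\in\mathbb R$ is the point at which $F$ attains its minimum, $F(u_0)=\min_{u\in\mathbb R}F(u)<0$ (under the assumptions $F$ is strictly convex with $F(0)=F(\lambda)=0$). Process: for fixed $\omega$ with values in $(0,1)$, $N\ge2$, $1\le k\le N-1$, let $\Omega_{N,k}=\{\xi\in\{0,1\}^N:\sum_{x=1}^N\xi(x)=k\}$, and let $\xi^{x,x+1}$ be obtained from $\xi$ by exchanging the values at $x$ and $x+1$. The simple exclusion process in environment $\omega$ is the continuous-time Markov chain on $\Omega_{N,k}$ which, for $1\le x\le N-1$, jumps from $\xi$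 to $\xi^{x,x+1}$ at rate $\omega_x$ if $\xi(x)=1,\xi(x+1)=0$ and at rate $1-\omega_{x+1}$ if $\xi(x)=0,\xi(x+1)=1$; there are no other jumps. Let $P_t(\xi,\cdot)$ be its law at time $t$ started from $\xi$. Its unique invariant probability measure is $\pi^\omega_{N,k}(\xi)\propto e^{-V^\omega(\xi)}$, where $V^\omega(1)=0$, $V^\omega(x)=\sum_{y=2}^x\log\frac{1-\omega_y}{\omega_{y-1}}$ for $x\ge2$, and $V^\omega(\xi)=\sum_{x=1}^N V^\omega(x)\xi(x)$. Set $d^\omega_{N,k}(t)=\max_{\xi}\|P_t(\xi,\cdot)-\pi^\omega_{N,k}\|_{\mathrm{TV}}$ (with $\|\nu_1-\nu_2\|_{\mathrm{TV}}=\sup_A|\nu_1(A)-\nu_2(A)|$) and $t^{N,k,\omega}_{\mathrm{mix}}=\inf\{t\ge0:d^\omega_{N,k}(t)\le1/4\}$. *)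

theory Defs
  imports "HOL-Probability.Probability"
begin

definition rho :: "real \<Rightarrow> real" where
  "rho w = (1 - w) / w"

context prob_space
begin

definition iid_environment :: "(int \<Rightarrow> 'a \<Rightarrow> real) \<Rightarrow> bool" where
  "iid_environment \<omega> \<longleftrightarrow>
     indep_vars (\<lambda>_. borel) \<omega> UNIV \<and>
     (\<forall>x. distr M borel (\<omega> x) = distr M borel (\<omega> 1))"

definition rho_moment :: "(int \<Rightarrow> 'a \<Rightarrow> real) \<Rightarrow> real \<Rightarrow> real" where
  "rho_moment \<omega> u = expectation (\<lambda>a. rho (\<omega> 1 a) powr u)"

text \<open>Extended-real valued, so that the infimum of the empty set is \<open>\<infinity>\<close>.\<close>

definition lambda_env :: "(int \<Rightarrow> 'a \<Rightarrow> real) \<Rightarrow> ereal" where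
  "lambda_env \<omega> = Inf {ereal s | s. s > 0 \<and> rho_moment \<omega> s \<ge> 1}"

definition F_env :: "(int \<Rightarrow> 'a \<Rightarrow> real) \<Rightarrow> real \<Rightarrow> real" where
  "F_env \<omega> u = ln (rho_moment \<omega> u)"

text \<open>Under the assumptions used here \<open>F_env \<omega>\<close> is strictly convex and tends to infinity at both ends,
  so that the minimiser exists and is unique.\<close>

definition u0_env :: "(int \<Rightarrow> 'a \<Rightarrow> real) \<Rightarrow> real" where
  "u0_env \<omega> = (ARG_MIN (F_env \<omega>) u. True)"

end

text \<open>Configurations are functions on all of the integers, fixed to \<open>undefined\<close> off the
  segment, so that each element of \<open>{0,1}\<^sup>N\<close> is represented exactly once.\<close>

definition configs :: "nat \<Rightarrow> nat \<Rightarrow> (int \<Rightarrow> nat) set" where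
  "configs N k = {\<xi> \<in> {1..int N} \<rightarrow>\<^sub>E {0, 1}. (\<Sum>x = 1..int N. \<xi> x) = k}"

definition exchange :: "(int \<Rightarrow> nat) \<Rightarrow> int \<Rightarrow> int \<Rightarrow> nat" where
  "exchange \<xi> x = \<xi>(x := \<xi> (x + 1), x + 1 := \<xi> x)"

definition jump_rate :: "(int \<Rightarrow> real) \<Rightarrow> (int \<Rightarrow> nat) \<Rightarrow> int \<Rightarrow> real" where
  "jump_rate w \<xi> x =
     (if \<xi> x = 1 \<and> \<xi> (x + 1) = 0 then w x
      else if \<xi> x = 0 \<and> \<xi> (x + 1) = 1 then 1 - w (x + 1)
      else 0)"

definition generator ::
  "(int \<Rightarrow> real) \<Rightarrow> nat \<Rightarrow> ((int \<Rightarrow> nat) \<Rightarrow> real) \<Rightarrow> (int \<Rightarrow> nat) \<Rightarrow> real" where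
  "generator w N f \<xi> = (\<Sum>x = 1..int N - 1. jump_rate w \<xi> x * (f (exchange \<xi> x) - f \<xi>))"

text \<open>The semigroup \<open>exp (t L)\<close> of the chain with generator \<open>L\<close>, as a power series. The moves
  preserve \<open>configs N k\<close>, which is finite, so for a configuration \<open>\<xi>\<close> in this set the series
  is that of the matrix exponential of the rate matrix on \<open>configs N k\<close>.\<close>

definition semigroup ::
  "(int \<Rightarrow> real) \<Rightarrow> nat \<Rightarrow> real \<Rightarrow> ((int \<Rightarrow> nat) \<Rightarrow> real) \<Rightarrow> (int \<Rightarrow> nat) \<Rightarrow> real" where
  "semigroup w N t f \<xi> = (\<Sum>n. t ^ n / fact n * (generator w N ^^ n) f \<xi>)"

definition law_at :: "(int \<Rightarrow> real) \<Rightarrow> nat \<Rightarrow> real \<Rightarrow> (int \<Rightarrow> nat) \<Rightarrow> (int \<Rightarrow> nat) set \<Rightarrow> real" where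
  "law_at w N t \<xi> A = semigroup w N t (indicator A) \<xi>"

definition potential :: "(int \<Rightarrow> real) \<Rightarrow> int \<Rightarrow> real" where
  "potential w x = (\<Sum>y = 2..x. ln ((1 - w y) / w (y - 1)))"

definition config_potential :: "(int \<Rightarrow> real) \<Rightarrow> nat \<Rightarrow> (int \<Rightarrow> nat) \<Rightarrow> real" where
  "config_potential w N \<xi> = (\<Sum>x = 1..int N. potential w x * real (\<xi> x))"

definition equilibrium :: "(int \<Rightarrow> real) \<Rightarrow> nat \<Rightarrow> nat \<Rightarrow> (int \<Rightarrow> nat) set \<Rightarrow> real" where
  "equilibrium w N k A =
     (\<Sum>\<xi>\<in>A \<inter> configs N k. exp (- config_potential w N \<xi>)) /
     (\<Sum>\<xi>\<in>configs N k. exp (- config_potential w N \<xi>))"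

definition tv_dist :: "'s set \<Rightarrow> ('s set \<Rightarrow> real) \<Rightarrow> ('s set \<Rightarrow> real) \<Rightarrow> real" where
  "tv_dist S \<nu>\<^sub>1 \<nu>\<^sub>2 = (SUP A\<in>Pow S. \<bar>\<nu>\<^sub>1 A - \<nu>\<^sub>2 A\<bar>)"

definition max_dist :: "(int \<Rightarrow> real) \<Rightarrow> nat \<Rightarrow> nat \<Rightarrow> real \<Rightarrow> real" where
  "max_dist w N k t =
     (MAX \<xi>\<in>configs N k. tv_dist (configs N k) (law_at w N t \<xi>) (equilibrium w N k))"

text \<open>Extended-real valued: an infimum over the empty set, which could only arise for an environment
  with values outside the open unit interval, is \<open>\<infinity>\<close> instead of an unspecified real.\<close>

definition t_mix :: "(int \<Rightarrow> real) \<Rightarrow> nat \<Rightarrow> nat \<Rightarrow> ereal" where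
  "t_mix w N k = Inf {ereal t | t. t \<ge> 0 \<and> max_dist w N k t \<le> 1 / 4}"

end

theory Submission
  imports Defs
begin

text \<open>
  A spectral gap bound obtained from canonical paths. Write \<open>V\<close> for the potential, \<open>W\<close> for the Gibbs
  weight of a set of occupied sites, and let \<open>G\<close> be a set of \<open>k\<close> sites of least total potential.
  A set \<open>A\<close> is turned into \<open>G\<close> by successively moving a particle from a site of \<open>A - G\<close> to a site of
  \<open>G - A\<close>. The intermediate sets \<open>B\<close> satisfy \<open>A \<inter> G \<subseteq> B \<subseteq> A \<union> G\<close>, and the identity
  \<open>W A * W G = W B * W ((A \<union> G) - B \<union> (A \<inter> G))\<close> bounds the weight of all \<open>A\<close> whose path visits \<open>B\<close>
  by \<open>W B * Z / W G\<close>. A single such move is a cascade of nearest neighbour jumps, in which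
  every particle on the way advances to the position of the next one. As the target has lower potential than the
  source, the energy rises along it by at most three times the largest increase \<open>h\<close> of \<open>V\<close> from
  left to right. Hence the inverse gap is at most of order \<open>k * N^4 * exp (3 * h) * Z / W G\<close>.

  With high probability \<open>h\<close> is at most \<open>4 / (3 * u\<^sub>0) * ln N\<close> up to a constant, and \<open>V\<close> decreases by almost
  \<open>2 * ln N\<close> over any distance \<open>q = c * ln N\<close>. The latter leaves at most \<open>2 * q + 2\<close> sites whose potential is
  close to the largest potential in \<open>G\<close>, so that \<open>Z / W G\<close> is of order \<open>4 powr q\<close>. Since \<open>\<bar>F u\<^sub>0\<bar> \<le> u\<^sub>0 * ln ((1 - \<alpha>) / \<alpha>)\<close>, the
  exponent in the theorem is at least \<open>6 + 4 / u\<^sub>0 + c * ln 4\<close>, which is more than required.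
\<close>

section \<open>Moving a particle through a configuration\<close>

definition occ_sets :: "nat \<Rightarrow> nat \<Rightarrow> int set set" where
  "occ_sets N k = {A. A \<subseteq> {1..int N} \<and> card A = k}"

definition energy :: "(int \<Rightarrow> real) \<Rightarrow> int set \<Rightarrow> real" where
  "energy V A = (\<Sum>x\<in>A. V x)"

definition weight :: "(int \<Rightarrow> real) \<Rightarrow> int set \<Rightarrow> real" where
  "weight V A = exp (- energy V A)"

definition hop :: "int set \<Rightarrow> int \<Rightarrow> int set" where
  "hop A x = insert (x + 1) (A - {x})"

definition hoppable :: "nat \<Rightarrow> nat \<Rightarrow> int \<Rightarrow> int set set" where
  "hoppable N k x = {A \<in> occ_sets N k. x \<in> A \<and> x + 1 \<notin> A}"

text \<open>The Dirichlet form with all jump rates set to one. Every pair of configurations joined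
  by a jump occurs once, seen from the member whose particle is on the left.\<close>

definition hop_energy :: "(int \<Rightarrow> real) \<Rightarrow> nat \<Rightarrow> nat \<Rightarrow> (int set \<Rightarrow> real) \<Rightarrow> real" where
  "hop_energy V N k f =
     (\<Sum>x = 1..int N - 1. \<Sum>A\<in>hoppable N k x. weight V A * (f (hop A x) - f A)\<^sup>2)"

lemma weight_pos [simp]: "0 < weight V A"
  by (simp add: weight_def)

lemma weight_nonneg [simp]: "0 \<le> weight V A"
  by (simp add: weight_def)

lemma finite_occ_sets [simp]: "finite (occ_sets N k)"
  by (rule finite_subset [of _ "Pow {1..int N}"]) (auto simp: occ_sets_def)

lemma finite_hoppable [simp]: "finite (hoppable N k x)"
  by (simp add: hoppable_def)

lemma finite_occ_set: "A \<in> occ_sets N k \<Longrightarrow> finite A"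
  by (auto simp: occ_sets_def intro: finite_subset)

lemma int_telescope:
  fixes g :: "int \<Rightarrow> real"
  assumes "a \<le> b"
  shows "(\<Sum>y\<in>{a..<b}. g y - g (y + 1)) = g a - g b"
  using assms
proof (induction b rule: int_ge_induct)
  case (step b)
  have "{a..<b + 1} = insert b {a..<b}" using step.hyps by auto
  then show ?case using step.IH by simp
qed simp

text \<open>In a cascade that fills the vacant site \<open>b\<close>, with \<open>X = insert b B\<close>, the particle at \<open>y\<close> is on its way
  from \<open>c\<close> to \<open>c'\<close>. The cases \<open>c' = b\<close> and \<open>y = c\<close> are included.\<close>

definition cascade_state :: "int set \<Rightarrow> int \<Rightarrow> int \<Rightarrow> int \<Rightarrow> int set" where
  "cascade_state X c c' y = insert y (X - {c, c'})"

text \<open>\<open>S\<close> is the state just before the jump from \<open>y\<close> to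
  \<open>y + 1\<close>. Both \<open>c\<close> and \<open>c'\<close> are confined to the interval
  from \<open>a\<close> to \<open>b\<close>, so that potentials can be compared there, and
  \<open>X\<close> stays the same during the whole cascade.\<close>

definition cascade_step :: "int set \<Rightarrow> int \<Rightarrow> int \<Rightarrow> int \<Rightarrow> int set \<Rightarrow> bool" where
  "cascade_step X a b y S \<longleftrightarrow> y + 1 \<notin> S \<and> (\<exists>c c'. a \<le> c \<and> c \<le> y \<and> y < c' \<and> c' \<le> b \<and>
     c \<in> X \<and> c' \<in> X \<and> y \<notin> X - {c, c'} \<and> S = cascade_state X c c' y)"

lemma cascade_stepI:
  assumes "y + 1 \<notin> S" "a \<le> c" "c \<le> y" "y < c'" "c' \<le> b" "c \<in> X" "c' \<in> X"
    "y \<notin> X - {c, c'}" "S = cascade_state X c c' y"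
  shows "cascade_step X a b y S"
  unfolding cascade_step_def using assms by blast

lemma cascade_step_mono:
  assumes "cascade_step X a b y S" "b \<le> b'"
  shows "cascade_step X a b' y S"
proof -
  obtain c c' where "y + 1 \<notin> S" "a \<le> c" "c \<le> y" "y < c'" "c' \<le> b" "c \<in> X" "c' \<in> X"
    "y \<notin> X - {c, c'}" "S = cascade_state X c c' y"
    using assms(1) unfolding cascade_step_def by blast
  then show ?thesis
    by (intro cascade_stepI [of y S a c c' b' X] order_trans [OF _ \<open>b \<le> b'\<close>])
qed

text \<open>Induction on the distance: the rightmost particle \<open>c\<close> in front of
  \<open>b\<close> runs freely to \<open>b\<close>, which leaves the vacancy \<open>c\<close> as the
  next target. Each bond between \<open>a\<close> and \<open>b\<close> is crossed exactly once, so
  the increments of \<open>f\<close> can be indexed by \<open>y\<close>.\<close>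

lemma right_cascade:
  fixes f :: "int set \<Rightarrow> real"
  assumes "a < b" "a \<in> B" "b \<notin> B"
  shows "\<exists>S. f B - f (insert b (B - {a})) = (\<Sum>y\<in>{a..<b}. f (S y) - f (hop (S y) y)) \<and>
    (\<forall>y\<in>{a..<b}. cascade_step (insert b B) a b y (S y))"
  using assms
proof (induction "nat (b - a)" arbitrary: b B rule: less_induct)
  case (less b B)
  define c where "c = Max (B \<inter> {a..<b})"
  have fin: "finite (B \<inter> {a..<b})" and ne: "B \<inter> {a..<b} \<noteq> {}"
    using less.prems by auto
  have cB: "c \<in> B" "a \<le> c" "c < b" using Max_in [OF fin ne] by (auto simp: c_def)
  have gap: "y \<notin> B" if "c < y" "y < b" for y
  proof
    assume "y \<in> B"
    then have "y \<le> c" unfolding c_def using that cB by (intro Max_ge fin) auto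
    then show False using that by simp
  qed
  define R where "R = (\<lambda>y. insert y (B - {c}))"
  have R_hop: "hop (R y) y = R (y + 1)" if "c \<le> y" "y < b" for y
    using that gap by (cases "y = c") (auto simp: R_def hop_def)
  have R_sum: "(\<Sum>y\<in>{c..<b}. f (R y) - f (hop (R y) y)) = f B - f (insert b (B - {c}))"
  proof -
    have "(\<Sum>y\<in>{c..<b}. f (R y) - f (hop (R y) y)) = (\<Sum>y\<in>{c..<b}. f (R y) - f (R (y + 1)))"
      by (intro sum.cong) (auto simp: R_hop)
    also have "\<dots> = f (R c) - f (R b)" using cB by (intro int_telescope) simp
    also have "R c = B" using cB by (auto simp: R_def)
    finally show ?thesis by (simp add: R_def)
  qed
  have R_step: "cascade_step (insert b B) a b y (R y)" if y: "c \<le> y" "y < b" for y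
  proof (rule cascade_stepI)
    show "y + 1 \<notin> R y"
      using y gap [of "y + 1"] less.prems(3) by (cases "y + 1 = b") (auto simp: R_def)
    show "y \<notin> insert b B - {c, b}" using y gap [of y] by (cases "y = c") auto
    show "R y = cascade_state (insert b B) c b y"
      using less.prems(3) cB by (auto simp: R_def cascade_state_def)
  qed (use y cB in auto)
  show ?case
  proof (cases "c = a")
    case True
    show ?thesis
      using R_sum R_step by (intro exI [of _ R]) (simp add: True)
  next
    case False
    then have "a < c" using cB by simp
    define B' where "B' = insert b (B - {c})"
    \<comment> \<open>The vacancy has moved from \<open>b\<close> to \<open>c\<close>, but together
      with the particles it still forms the same set. Hence the induction hypothesis speaks about
      the same \<open>X\<close>.\<close>
    have X: "insert c B' = insert b B" using cB by (auto simp: B'_def)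
    have B': "a \<in> B'" "c \<notin> B'" "insert c (B' - {a}) = insert b (B - {a})"
      using less.prems cB \<open>a < c\<close> by (auto simp: B'_def)
    have "nat (c - a) < nat (b - a)" using cB \<open>a < c\<close> by simp
    from less.hyps [OF this \<open>a < c\<close> B'(1,2), unfolded X]
    obtain S where S: "f B' - f (insert c (B' - {a})) = (\<Sum>y\<in>{a..<c}. f (S y) - f (hop (S y) y))"
      and S_step: "\<forall>y\<in>{a..<c}. cascade_step (insert b B) a c y (S y)"
      by blast
    \<comment> \<open>Jumps are indexed by position and not by time: those over
      \<open>{c..<b}\<close> are performed first.\<close>
    define U where "U y = (if y < c then S y else R y)" for y
    have "{a..<b} = {a..<c} \<union> {c..<b}" using cB by auto
    then have "(\<Sum>y\<in>{a..<b}. f (U y) - f (hop (U y) y)) =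
        (\<Sum>y\<in>{a..<c}. f (U y) - f (hop (U y) y)) + (\<Sum>y\<in>{c..<b}. f (U y) - f (hop (U y) y))"
      by (simp add: sum.union_disjoint ivl_disj_int)
    also have "(\<Sum>y\<in>{a..<c}. f (U y) - f (hop (U y) y)) = f B' - f (insert c (B' - {a}))"
      unfolding S by (intro sum.cong) (auto simp: U_def)
    also have "(\<Sum>y\<in>{c..<b}. f (U y) - f (hop (U y) y)) = f B - f (insert b (B - {c}))"
      unfolding R_sum [symmetric] by (intro sum.cong) (auto simp: U_def)
    finally have "f B - f (insert b (B - {a})) = (\<Sum>y\<in>{a..<b}. f (U y) - f (hop (U y) y))"
      using B' by (simp add: B'_def)
    moreover have "cascade_step (insert b B) a b y (U y)" if "y \<in> {a..<b}" for y
    proof (cases "y < c")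
      case True
      then have "cascade_step (insert b B) a c y (U y)" using S_step that by (auto simp: U_def)
      then show ?thesis by (rule cascade_step_mono) (use cB in simp)
    next
      case False
      then show ?thesis using R_step that by (auto simp: U_def)
    qed
    ultimately show ?thesis by (intro exI [of _ U]) simp
  qed
qed

lemma energy_cascade_state:
  assumes "finite B" "b \<notin> B" "c \<in> insert b B" "c' \<in> insert b B" "c \<noteq> c'"
    and "y \<notin> insert b B - {c, c'}"
  shows "energy V (cascade_state (insert b B) c c' y) = energy V B + V b + V y - V c - V c'"
proof -
  let ?X = "insert b B"
  have "energy V (cascade_state ?X c c' y) = V y + (\<Sum>x\<in>?X - {c, c'}. V x)"
    using assms by (simp add: energy_def cascade_state_def)
  also have "(\<Sum>x\<in>?X - {c, c'}. V x) = (\<Sum>x\<in>?X. V x) - (\<Sum>x\<in>{c, c'}. V x)"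
    using assms by (intro sum_diff) auto
  also have "(\<Sum>x\<in>?X. V x) = V b + energy V B" using assms by (simp add: energy_def)
  finally show ?thesis using assms by (simp add: algebra_simps)
qed

lemma card_cascade_state:
  assumes "finite B" "b \<notin> B" "c \<in> insert b B" "c' \<in> insert b B" "c \<noteq> c'"
    and "y \<notin> insert b B - {c, c'}"
  shows "card (cascade_state (insert b B) c c' y) = card B"
proof -
  have "card {c, c'} = 2" using assms by simp
  moreover have "card (insert b B - {c, c'}) = card (insert b B) - card {c, c'}"
    using assms by (intro card_Diff_subset) auto
  moreover have "card {c, c'} \<le> card (insert b B)" by (rule card_mono) (use assms in auto)
  ultimately show ?thesis using assms by (simp add: cascade_state_def)
qed

text \<open>Injectivity behind the congestion estimate: once \<open>b\<close>, \<open>c\<close>,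
  \<open>c'\<close> and \<open>y\<close> are fixed, an intermediate state belongs to at most one
  starting set.\<close>

lemma cascade_state_inj:
  assumes "b \<notin> B" "c \<in> insert b B" "c' \<in> insert b B" "y \<notin> insert b B - {c, c'}"
  shows "B = ((cascade_state (insert b B) c c' y - {y}) \<union> {c, c'}) - {b}"
  using assms by (auto simp: cascade_state_def)

section \<open>The cost of exchanging an occupied and a vacant site\<close>

text \<open>Cauchy-Schwarz along the cascade costs the factor \<open>N\<close>, and the rise of the
  energy costs \<open>exp (3 * h)\<close>. The sum runs over all \<open>c\<close> and
  \<open>c'\<close> instead of the pair that occurs at \<open>y\<close>, which prepares the
  injectivity argument for fixed parameters.\<close>

lemma exchange_bound:
  fixes f :: "int set \<Rightarrow> real"
  assumes B: "B \<in> occ_sets N k" and a: "a \<in> B" and b: "b \<notin> B" "b \<in> {1..int N}"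
    and Vba: "V b \<le> V a" and h: "\<And>x y. 1 \<le> x \<Longrightarrow> x \<le> y \<Longrightarrow> y \<le> int N \<Longrightarrow> V y - V x \<le> h"
  shows "weight V B * (f B - f (insert b (B - {a})))\<^sup>2 \<le> real N * exp (3 * h) *
    (\<Sum>y = 1..int N - 1. \<Sum>c = 1..int N. \<Sum>c' = 1..int N.
       if c \<in> insert b B \<and> c' \<in> insert b B \<and> y \<notin> insert b B - {c, c'} \<and>
          cascade_state (insert b B) c c' y \<in> hoppable N k y
       then (let S = cascade_state (insert b B) c c' y in weight V S * (f (hop S y) - f S)\<^sup>2)
       else 0)" (is "_ \<le> _ * (\<Sum>y = _.._. \<Sum>c = _.._. \<Sum>c' = _.._. ?t y c c')")
proof -
  let ?X = "insert b B"
  have aN: "a \<in> {1..int N}" and finB: "finite B" and BN: "B \<subseteq> {1..int N}" and cardB: "card B = k"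
    using B a finite_occ_set [OF B] by (auto simp: occ_sets_def)
  have ab: "a \<noteq> b" using a b by auto
  define l u where "l = min a b" and "u = max a b"
  have lu: "l < u" "1 \<le> l" "u \<le> int N" using aN b ab by (auto simp: l_def u_def)
  have h0: "0 \<le> h" using h [of a a] aN by auto
  obtain S where S: "\<bar>f B - f (insert b (B - {a}))\<bar> = \<bar>\<Sum>y\<in>{l..<u}. f (S y) - f (hop (S y) y)\<bar>"
    and S': "\<forall>y\<in>{l..<u}. cascade_step ?X l u y (S y)"
  proof (cases "a < b")
    case True
    then have lu_eq: "l = a" "u = b" by (auto simp: l_def u_def)
    obtain S where "f B - f (insert b (B - {a})) = (\<Sum>y\<in>{l..<u}. f (S y) - f (hop (S y) y))"
      "\<forall>y\<in>{l..<u}. cascade_step ?X l u y (S y)"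
      using right_cascade [OF True a b(1), of f] unfolding lu_eq by blast
    then show ?thesis by (intro that [of S]) auto
  next
    case False
    then have "b < a" using ab by simp
    have lu_eq: "l = b" "u = a" using \<open>b < a\<close> by (auto simp: l_def u_def)
    \<comment> \<open>A move to the left is a right cascade run backwards: it takes a particle of
      \<open>B'\<close> from \<open>b\<close> to \<open>a\<close>, and \<open>insert a B'\<close> is
      again \<open>insert b B\<close>.\<close>
    define B' where "B' = insert b (B - {a})"
    have X: "insert a B' = ?X" "insert a (B' - {b}) = B" "b \<in> B'" "a \<notin> B'"
      using a b ab by (auto simp: B'_def)
    obtain S where "f B' - f B = (\<Sum>y\<in>{l..<u}. f (S y) - f (hop (S y) y))"
      "\<forall>y\<in>{l..<u}. cascade_step ?X l u y (S y)"
      using right_cascade [OF \<open>b < a\<close> X(3,4), of f] unfolding X(1,2) lu_eq by blast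
    then show ?thesis unfolding B'_def
      by (intro that [of S]) (simp_all add: abs_minus_commute flip: B'_def)
  qed
  have step: "weight V B * (f (S y) - f (hop (S y) y))\<^sup>2 \<le>
      exp (3 * h) * (\<Sum>c = 1..int N. \<Sum>c' = 1..int N. ?t y c c')" if y: "y \<in> {l..<u}" for y
  proof -
    obtain c c' where y1: "y + 1 \<notin> S y" and c: "l \<le> c" "c \<le> y" "y < c'" "c' \<le> u"
      "c \<in> ?X" "c' \<in> ?X" "y \<notin> ?X - {c, c'}" and Sy: "S y = cascade_state ?X c c' y"
      using S' y unfolding cascade_step_def by blast
    have cc: "c \<in> {1..int N}" "c' \<in> {1..int N}" "c \<noteq> c'" using c lu by auto
    have E: "energy V (S y) = energy V B + V b + V y - V c - V c'"
      unfolding Sy using c cc b finB by (intro energy_cascade_state) auto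
    \<comment> \<open>For \<open>a < b\<close>, the site \<open>b\<close> is paired with
      \<open>c'\<close> and \<open>y\<close> with \<open>c\<close>. Otherwise the left-hand side
      equals \<open>(V y - V b) + (V a - V c) + (V a - V c') + 2 * (V b - V a)\<close>, whose last
      term is at most 0.\<close>
    have "V b + V y - V c - V c' \<le> 3 * h"
    proof (cases "a < b")
      case True
      have "V b - V c' \<le> h" "V y - V c \<le> h" using True c lu b by (auto intro!: h simp: l_def u_def)
      then show ?thesis using h0 by simp
    next
      case False
      have "V y - V b \<le> h" "V a - V c \<le> h" "V a - V c' \<le> h"
        using False c lu b aN by (auto intro!: h simp: l_def u_def)
      then show ?thesis using Vba by linarith
    qed
    then have W: "weight V B \<le> exp (3 * h) * weight V (S y)"
      by (simp add: weight_def E flip: exp_add)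
    have "card (S y) = k" unfolding Sy
      using card_cascade_state [OF finB b(1) c(5,6) cc(3) c(7)] cardB by simp
    moreover have "S y \<subseteq> {1..int N}" using Sy BN b c lu by (auto simp: cascade_state_def)
    ultimately have hopS: "S y \<in> hoppable N k y"
      using y1 by (auto simp: hoppable_def occ_sets_def Sy cascade_state_def)
    have "?t y c c' \<le> (\<Sum>c' = 1..int N. ?t y c c')"
      using cc by (intro member_le_sum) (auto simp: Let_def)
    also have "\<dots> \<le> (\<Sum>c = 1..int N. \<Sum>c' = 1..int N. ?t y c c')"
      using cc by (intro member_le_sum [of c _ "\<lambda>c. \<Sum>c' = 1..int N. ?t y c c'"] sum_nonneg)
        (auto simp: Let_def)
    finally have le: "weight V (S y) * (f (hop (S y) y) - f (S y))\<^sup>2 \<le> (\<Sum>c = 1..int N. \<Sum>c' = 1..int N. ?t y c c')"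
      using c hopS by (auto simp: Sy Let_def)
    have "weight V B * (f (S y) - f (hop (S y) y))\<^sup>2 \<le>
        exp (3 * h) * weight V (S y) * (f (hop (S y) y) - f (S y))\<^sup>2"
      using W by (subst power2_commute) (intro mult_right_mono, auto)
    also have "\<dots> \<le> exp (3 * h) * (\<Sum>c = 1..int N. \<Sum>c' = 1..int N. ?t y c c')"
      using le by (simp add: mult.assoc)
    finally show ?thesis .
  qed
  have t0: "0 \<le> (\<Sum>c = 1..int N. \<Sum>c' = 1..int N. ?t y c c')" for y
    by (intro sum_nonneg) (auto simp: Let_def)
  have "(f B - f (insert b (B - {a})))\<^sup>2 = (\<Sum>y\<in>{l..<u}. f (S y) - f (hop (S y) y))\<^sup>2"
    using S by (simp add: power2_eq_iff abs_eq_iff)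
  also have "\<dots> \<le> real (card {l..<u}) * (\<Sum>y\<in>{l..<u}. (f (S y) - f (hop (S y) y))\<^sup>2)"
    using sum_squared_le_sum_of_squares [of "\<lambda>y. f (S y) - f (hop (S y) y)" "{l..<u}"]
    by (simp add: mult.commute)
  also have "\<dots> \<le> real N * (\<Sum>y\<in>{l..<u}. (f (S y) - f (hop (S y) y))\<^sup>2)"
    using lu by (intro mult_right_mono sum_nonneg) auto
  finally have "weight V B * (f B - f (insert b (B - {a})))\<^sup>2 \<le>
      weight V B * (real N * (\<Sum>y\<in>{l..<u}. (f (S y) - f (hop (S y) y))\<^sup>2))"
    by (intro mult_left_mono) auto
  also have "\<dots> = real N * (\<Sum>y\<in>{l..<u}. weight V B * (f (S y) - f (hop (S y) y))\<^sup>2)"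
    by (simp add: sum_distrib_left mult_ac)
  also have "\<dots> \<le> real N * (\<Sum>y\<in>{l..<u}. exp (3 * h) * (\<Sum>c = 1..int N. \<Sum>c' = 1..int N. ?t y c c'))"
    by (intro mult_left_mono sum_mono step) auto
  also have "\<dots> \<le> real N * (\<Sum>y = 1..int N - 1. exp (3 * h) * (\<Sum>c = 1..int N. \<Sum>c' = 1..int N. ?t y c c'))"
    using lu by (intro mult_left_mono sum_mono2 mult_nonneg_nonneg t0) auto
  finally show ?thesis by (simp add: sum_distrib_left mult.assoc)
qed

text \<open>Of the four factors \<open>N\<close>, one comes from Cauchy-Schwarz and three count the
  values of \<open>b\<close>, \<open>c\<close> and \<open>c'\<close>. With these and
  \<open>y\<close> fixed, distinct \<open>B\<close> yield distinct intermediate states, so their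
  contributions are part of the energy at the bond \<open>y\<close>.\<close>

lemma exchange_sum_bound:
  fixes f :: "int set \<Rightarrow> real" and a b :: "int set \<Rightarrow> int"
  assumes \<B>: "\<B> \<subseteq> occ_sets N k"
    and ab: "\<And>B. B \<in> \<B> \<Longrightarrow> a B \<in> B \<and> b B \<notin> B \<and> b B \<in> {1..int N} \<and> V (b B) \<le> V (a B)"
    and h: "\<And>x y. 1 \<le> x \<Longrightarrow> x \<le> y \<Longrightarrow> y \<le> int N \<Longrightarrow> V y - V x \<le> h"
  shows "(\<Sum>B\<in>\<B>. weight V B * (f B - f (insert (b B) (B - {a B})))\<^sup>2) \<le>
     real N ^ 4 * exp (3 * h) * hop_energy V N k f"
proof -
  define t where "t B b y c c' = (if c \<in> insert b B \<and> c' \<in> insert b B \<and> y \<notin> insert b B - {c, c'} \<and>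
          cascade_state (insert b B) c c' y \<in> hoppable N k y
       then (let S = cascade_state (insert b B) c c' y in weight V S * (f (hop S y) - f S)\<^sup>2)
       else 0)" for B b y c c'
  define H where "H y = (\<Sum>A\<in>hoppable N k y. weight V A * (f (hop A y) - f A)\<^sup>2)" for y
  have fin: "finite \<B>" by (rule finite_subset [OF \<B>]) simp
  have H0: "0 \<le> H y" for y by (auto simp: H_def intro!: sum_nonneg)
  have t0: "0 \<le> t B b y c c'" for B b y c c' by (auto simp: t_def Let_def)
  have inj: "(\<Sum>B\<in>{B\<in>\<B>. b' \<notin> B}. t B b' y c c') \<le> H y" for b' y c c'
  proof -
    define P where "P = {B\<in>\<B>. b' \<notin> B \<and> c \<in> insert b' B \<and> c' \<in> insert b' B \<and>
      y \<notin> insert b' B - {c, c'} \<and> cascade_state (insert b' B) c c' y \<in> hoppable N k y}"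
    let ?S = "\<lambda>B. cascade_state (insert b' B) c c' y"
    have "inj_on ?S P"
    proof (rule inj_on_inverseI)
      fix B assume "B \<in> P"
      then show "((?S B - {y}) \<union> {c, c'}) - {b'} = B"
        using cascade_state_inj [of b' B c c' y] by (simp add: P_def)
    qed
    have "(\<Sum>B\<in>{B\<in>\<B>. b' \<notin> B}. t B b' y c c') =
       (\<Sum>B\<in>P. (\<lambda>S. weight V S * (f (hop S y) - f S)\<^sup>2) (?S B))"
      using fin by (intro sum.mono_neutral_cong_right) (auto simp: P_def t_def Let_def)
    also have "\<dots> = (\<Sum>S\<in>?S ` P. weight V S * (f (hop S y) - f S)\<^sup>2)"
      using \<open>inj_on ?S P\<close> by (simp add: sum.reindex)
    also have "\<dots> \<le> H y" unfolding H_def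
      by (intro sum_mono2) (auto simp: P_def)
    finally show ?thesis .
  qed
  have "(\<Sum>B\<in>\<B>. weight V B * (f B - f (insert (b B) (B - {a B})))\<^sup>2) \<le>
     (\<Sum>B\<in>\<B>. real N * exp (3 * h) *
       (\<Sum>y = 1..int N - 1. \<Sum>c = 1..int N. \<Sum>c' = 1..int N. t B (b B) y c c'))"
    unfolding t_def using ab \<B> by (intro sum_mono exchange_bound h) auto
  \<comment> \<open>The site \<open>b B\<close> varies with \<open>B\<close>. Summing over all
    vacant \<open>b'\<close> decouples the two, after which the sums can be interchanged.\<close>
  also have "\<dots> \<le> (\<Sum>B\<in>\<B>. real N * exp (3 * h) *
       (\<Sum>b'\<in>{1..int N}. if b' \<notin> B then \<Sum>y = 1..int N - 1. \<Sum>c = 1..int N. \<Sum>c' = 1..int N. t B b' y c c' else 0))"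
  proof (intro sum_mono mult_left_mono)
    fix B assume B: "B \<in> \<B>"
    let ?g = "\<lambda>b'. if b' \<notin> B then \<Sum>y = 1..int N - 1. \<Sum>c = 1..int N. \<Sum>c' = 1..int N. t B b' y c c' else 0"
    have "?g (b B) \<le> (\<Sum>b'\<in>{1..int N}. ?g b')"
      using ab [OF B] by (intro member_le_sum) (auto intro!: sum_nonneg t0)
    then show "(\<Sum>y = 1..int N - 1. \<Sum>c = 1..int N. \<Sum>c' = 1..int N. t B (b B) y c c') \<le> (\<Sum>b'\<in>{1..int N}. ?g b')"
      using ab [OF B] by simp
  qed auto
  also have "\<dots> = real N * exp (3 * h) * (\<Sum>b'\<in>{1..int N}. \<Sum>B\<in>\<B>.
      if b' \<notin> B then \<Sum>y = 1..int N - 1. \<Sum>c = 1..int N. \<Sum>c' = 1..int N. t B b' y c c' else 0)"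
    unfolding sum_distrib_left [symmetric] by (subst sum.swap) simp
  also have "\<dots> = real N * exp (3 * h) * (\<Sum>b'\<in>{1..int N}. \<Sum>B\<in>{B\<in>\<B>. b' \<notin> B}.
      \<Sum>y = 1..int N - 1. \<Sum>c = 1..int N. \<Sum>c' = 1..int N. t B b' y c c')"
    using fin by (simp add: sum.inter_filter)
  also have "\<dots> = real N * exp (3 * h) * (\<Sum>b'\<in>{1..int N}.
      \<Sum>y = 1..int N - 1. \<Sum>c = 1..int N. \<Sum>c' = 1..int N. \<Sum>B\<in>{B\<in>\<B>. b' \<notin> B}. t B b' y c c')"
    by (intro arg_cong [of _ _ "(*) _"] sum.cong [OF refl] trans [OF sum.swap] refl)
  also have "\<dots> \<le> real N * exp (3 * h) * (\<Sum>b'\<in>{1..int N}.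
      \<Sum>y = 1..int N - 1. \<Sum>c = 1..int N. \<Sum>c' = 1..int N. H y)"
    by (intro mult_left_mono sum_mono inj) auto
  also have "\<dots> = real N ^ 4 * exp (3 * h) * (\<Sum>y = 1..int N - 1. H y)"
    by (simp add: power4_eq_xxxx flip: sum_distrib_left)
  finally show ?thesis by (simp add: hop_energy_def H_def)
qed

section \<open>Poincare inequality relative to the ground state\<close>

lemma exchange_occ_sets:
  assumes "A \<in> occ_sets N k" "a \<in> A" "b \<notin> A" "b \<in> {1..int N}"
  shows "insert b (A - {a}) \<in> occ_sets N k"
proof -
  have "finite A" using finite_occ_set [OF assms(1)] .
  then have "card (insert b (A - {a})) = card A"
    using assms(2,3) by (metis Diff_iff card.remove card_insert_disjoint finite_Diff)
  then show ?thesis using assms by (auto simp: occ_sets_def)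
qed

text \<open>Cauchy-Schwarz in a form suited to induction on the number of steps: the weighted
  inequality \<open>2 * x * y \<le> m * x\<^sup>2 + y\<^sup>2 / m\<close> raises the constant from
  \<open>m\<close> to exactly \<open>m + 1\<close>.\<close>

lemma square_sum_split:
  fixes x y :: real
  assumes "y\<^sup>2 \<le> real m * S" "0 \<le> S"
  shows "(x + y)\<^sup>2 \<le> real (Suc m) * (x\<^sup>2 + S)"
proof (cases "m = 0")
  case True
  with assms show ?thesis by simp
next
  case False
  have "0 \<le> (real m * x - y)\<^sup>2 / real m" by simp
  also have "\<dots> = real m * x\<^sup>2 - 2 * x * y + y\<^sup>2 / real m"
    using False by (simp add: power2_diff field_simps power2_eq_square)
  also have "y\<^sup>2 / real m \<le> S" using assms(1) False by (simp add: field_simps)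
  finally have "2 * x * y \<le> real m * x\<^sup>2 + S" by simp
  then show ?thesis using assms(1) by (simp add: power2_sum algebra_simps)
qed

text \<open>Each exchange removes one element of \<open>A - G\<close>, so there are
  \<open>card (A - G)\<close> steps. The sum runs over all sets between \<open>A \<inter> G\<close>
  and \<open>A \<union> G\<close>, rather than over the path alone; such a condition can later be
  read as one on \<open>A\<close> for given \<open>B\<close>.\<close>

lemma descent_bound:
  fixes f :: "int set \<Rightarrow> real" and a b :: "int set \<Rightarrow> int"
  assumes G: "G \<in> occ_sets N k" and A: "A \<in> occ_sets N k"
    and ab: "\<And>B. B \<in> occ_sets N k \<Longrightarrow> B \<noteq> G \<Longrightarrow> a B \<in> B - G \<and> b B \<in> G - B"
  shows "(f A - f G)\<^sup>2 \<le> real (card (A - G)) *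
    (\<Sum>B | B \<in> occ_sets N k \<and> B \<noteq> G \<and> A \<inter> G \<subseteq> B \<and> B \<subseteq> A \<union> G.
       (f B - f (insert (b B) (B - {a B})))\<^sup>2)"
  using A
proof (induction "card (A - G)" arbitrary: A)
  case 0
  have "finite (A - G)" using finite_occ_set [OF 0(2)] by simp
  with 0 have "A \<subseteq> G" by simp
  then have "A = G" using 0(2) G finite_occ_set [OF G] by (intro card_subset_eq) (auto simp: occ_sets_def)
  then show ?case by simp
next
  case (Suc m A)
  let ?T = "\<lambda>A. insert (b A) (A - {a A})"
  let ?P = "\<lambda>A. {B \<in> occ_sets N k. B \<noteq> G \<and> A \<inter> G \<subseteq> B \<and> B \<subseteq> A \<union> G}"
  let ?g = "\<lambda>B. (f B - f (?T B))\<^sup>2"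
  have "A \<noteq> G" using Suc.hyps(2) by auto
  with ab Suc.prems have abA: "a A \<in> A" "a A \<notin> G" "b A \<in> G" "b A \<notin> A" by auto
  have T: "?T A \<in> occ_sets N k"
    using abA G Suc.prems by (intro exchange_occ_sets) (auto simp: occ_sets_def)
  have diff: "?T A - G = (A - G) - {a A}" using abA by auto
  have "card (?T A - G) = m"
    unfolding diff using Suc.hyps(2) abA finite_occ_set [OF Suc.prems] by simp
  with Suc.hyps(1) [of "?T A"] T
  have IH: "(f (?T A) - f G)\<^sup>2 \<le> real m * (\<Sum>B\<in>?P (?T A). ?g B)" by simp
  have "(f A - f G)\<^sup>2 = ((f A - f (?T A)) + (f (?T A) - f G))\<^sup>2" by simp
  also have "\<dots> \<le> real (Suc m) * (?g A + (\<Sum>B\<in>?P (?T A). ?g B))"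
    by (intro square_sum_split IH sum_nonneg) auto
  \<comment> \<open>\<open>A\<close> is not among the later sets, since \<open>a A\<close> lies
    neither in \<open>?T A\<close> nor in \<open>G\<close>.\<close>
  also have "?g A + (\<Sum>B\<in>?P (?T A). ?g B) = (\<Sum>B\<in>insert A (?P (?T A)). ?g B)"
    using abA by (subst sum.insert) auto
  also have "\<dots> \<le> (\<Sum>B\<in>?P A. ?g B)"
    using abA Suc.prems \<open>A \<noteq> G\<close> by (intro sum_mono2) auto
  finally show ?case using Suc.hyps(2) by simp
qed

lemma weight_mult:
  assumes "finite A" "finite B"
  shows "weight V A * weight V B = weight V (A \<union> B) * weight V (A \<inter> B)"
  using assms sum.union_inter [of A B V] by (simp add: weight_def energy_def flip: exp_add)

text \<open>For given \<open>B\<close> the set \<open>A\<close> is encoded by \<open>?c A\<close>,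
  which has with \<open>B\<close> the same union and the same intersection as \<open>A\<close> has
  with \<open>G\<close>. Hence the weights multiply alike, \<open>?c A\<close> has \<open>k\<close>
  elements, and \<open>A\<close> can be recovered from it.\<close>

lemma between_weight_bound:
  assumes G: "G \<in> occ_sets N k" and B: "B \<in> occ_sets N k"
  shows "(\<Sum>A | A \<in> occ_sets N k \<and> A \<inter> G \<subseteq> B \<and> B \<subseteq> A \<union> G. weight V A) \<le>
    weight V B * ((\<Sum>A\<in>occ_sets N k. weight V A) / weight V G)"
proof -
  let ?P = "{A \<in> occ_sets N k. A \<inter> G \<subseteq> B \<and> B \<subseteq> A \<union> G}"
  let ?c = "\<lambda>A. (A \<union> G) - B \<union> (A \<inter> G)"
  have c: "?c A \<in> occ_sets N k \<and> weight V A * weight V G = weight V B * weight V (?c A)"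
    if "A \<in> ?P" for A
  proof
    have fin: "finite A" "finite G" "finite B"
      using that G B finite_occ_set by auto
    have un: "B \<union> ?c A = A \<union> G" and int: "B \<inter> ?c A = A \<inter> G" using that by auto
    have "card B + card (?c A) = card A + card G"
      using card_Un_Int [of B "?c A"] card_Un_Int [of A G] fin unfolding un int by simp
    then show "?c A \<in> occ_sets N k" using that G B by (auto simp: occ_sets_def)
    show "weight V A * weight V G = weight V B * weight V (?c A)"
      using weight_mult [of A G V] weight_mult [of B "?c A" V] fin unfolding un int by simp
  qed
  have inj: "inj_on ?c ?P"
  proof (rule inj_on_inverseI)
    fix A assume "A \<in> ?P"
    then show "(?c A \<union> B) - G \<union> (?c A \<inter> B) = A" by auto
  qed
  have "(\<Sum>A\<in>?P. weight V A) = (\<Sum>A\<in>?P. weight V B * weight V (?c A) / weight V G)"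
  proof (intro sum.cong refl)
    fix A assume "A \<in> ?P"
    with c have "weight V A * weight V G = weight V B * weight V (?c A)" by blast
    then show "weight V A = weight V B * weight V (?c A) / weight V G"
      by (simp add: nonzero_eq_divide_eq less_imp_neq [OF weight_pos, symmetric])
  qed
  also have "\<dots> = weight V B / weight V G * (\<Sum>A\<in>?c ` ?P. weight V A)"
    by (simp add: sum.reindex [OF inj] sum_distrib_left)
  also have "\<dots> \<le> weight V B / weight V G * (\<Sum>A\<in>occ_sets N k. weight V A)"
    using c by (intro mult_left_mono sum_mono2) auto
  finally show ?thesis by (simp add: mult_ac)
qed

text \<open>The method of canonical paths: the descent bound is weighted and summed over
  \<open>A\<close>, the order of summation is reversed so that each \<open>B\<close> collects the
  weight of all \<open>A\<close> it lies between, and the exchanges are then charged to the hop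
  energy. The factor \<open>k\<close> bounds the number of exchanges.\<close>

theorem poincare_ground_state:
  fixes f :: "int set \<Rightarrow> real"
  assumes G: "G \<in> occ_sets N k"
    and ground: "\<And>a b. a \<in> G \<Longrightarrow> b \<in> {1..int N} - G \<Longrightarrow> V a \<le> V b"
    and h: "\<And>x y. 1 \<le> x \<Longrightarrow> x \<le> y \<Longrightarrow> y \<le> int N \<Longrightarrow> V y - V x \<le> h"
  shows "(\<Sum>A\<in>occ_sets N k. weight V A * (f A - f G)\<^sup>2) \<le>
    real k * ((\<Sum>A\<in>occ_sets N k. weight V A) / weight V G) *
      (real N ^ 4 * exp (3 * h) * hop_energy V N k f)"
proof -
  let ?Z = "(\<Sum>A\<in>occ_sets N k. weight V A) / weight V G"
  have "\<exists>a b. a \<in> B - G \<and> b \<in> G - B" if B: "B \<in> occ_sets N k" "B \<noteq> G" for B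
  proof -
    have "finite B" "finite G" "card B = card G" using finite_occ_set [OF B(1)] finite_occ_set [OF G] B(1) G
      by (simp_all add: occ_sets_def)
    with \<open>B \<noteq> G\<close> have "\<not> B \<subseteq> G" "\<not> G \<subseteq> B" by (metis card_subset_eq)+
    then show ?thesis by blast
  qed
  \<comment> \<open>The exchange is a function of \<open>B\<close> alone, so all descents through
    \<open>B\<close> continue in the same way.\<close>
  then obtain a b where ab: "\<And>B. B \<in> occ_sets N k \<Longrightarrow> B \<noteq> G \<Longrightarrow> a B \<in> B - G \<and> b B \<in> G - B"
    using that [of "\<lambda>B. SOME a. a \<in> B - G" "\<lambda>B. SOME b. b \<in> G - B"] by (metis someI)
  let ?g = "\<lambda>B. (f B - f (insert (b B) (B - {a B})))\<^sup>2"
  let ?\<Omega> = "occ_sets N k"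
  let ?btw = "\<lambda>A B. A \<inter> G \<subseteq> B \<and> B \<subseteq> A \<union> G"
  have "(\<Sum>A\<in>?\<Omega>. weight V A * (f A - f G)\<^sup>2) \<le>
      (\<Sum>A\<in>?\<Omega>. weight V A * (real k * (\<Sum>B | B \<in> ?\<Omega> - {G} \<and> ?btw A B. ?g B)))"
  proof (intro sum_mono mult_left_mono)
    fix A assume A: "A \<in> ?\<Omega>"
    have "card (A - G) \<le> k" using A finite_occ_set [OF A] card_mono [of A "A - G"] by (auto simp: occ_sets_def)
    then have "real (card (A - G)) * (\<Sum>B | B \<in> ?\<Omega> \<and> B \<noteq> G \<and> ?btw A B. ?g B) \<le>
        real k * (\<Sum>B | B \<in> ?\<Omega> \<and> B \<noteq> G \<and> ?btw A B. ?g B)"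
      by (intro mult_right_mono sum_nonneg) auto
    with descent_bound [OF G A ab, of f]
    show "(f A - f G)\<^sup>2 \<le> real k * (\<Sum>B | B \<in> ?\<Omega> - {G} \<and> ?btw A B. ?g B)" by simp
  qed simp
  also have "\<dots> = real k * (\<Sum>A\<in>?\<Omega>. \<Sum>B | B \<in> ?\<Omega> - {G} \<and> ?btw A B. weight V A * ?g B)"
    by (simp add: sum_distrib_left mult_ac)
  also have "\<dots> = real k * (\<Sum>B\<in>?\<Omega> - {G}. \<Sum>A | A \<in> ?\<Omega> \<and> ?btw A B. weight V A * ?g B)"
    by (subst sum.swap_restrict) auto
  also have "\<dots> = real k * (\<Sum>B\<in>?\<Omega> - {G}. (\<Sum>A | A \<in> ?\<Omega> \<and> ?btw A B. weight V A) * ?g B)"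
    by (simp add: sum_distrib_right)
  also have "\<dots> \<le> real k * (\<Sum>B\<in>?\<Omega> - {G}. (weight V B * ?Z) * ?g B)"
    using between_weight_bound [OF G]
    by (intro mult_left_mono sum_mono mult_right_mono) auto
  also have "\<dots> = real k * ?Z * (\<Sum>B\<in>?\<Omega> - {G}. weight V B * ?g B)"
    unfolding sum_distrib_left [of "real k"] sum_distrib_left [of "real k * ?Z"] by (intro sum.cong) simp_all
  also have "\<dots> \<le> real k * ?Z * (real N ^ 4 * exp (3 * h) * hop_energy V N k f)"
  proof (intro mult_left_mono exchange_sum_bound h)
    fix B assume "B \<in> ?\<Omega> - {G}"
    then have "B \<in> ?\<Omega>" "a B \<in> B - G \<and> b B \<in> G - B" using ab by auto
    moreover then have "V (b B) \<le> V (a B)" by (intro ground) (auto simp: occ_sets_def)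
    ultimately show "a B \<in> B \<and> b B \<notin> B \<and> b B \<in> {1..int N} \<and> V (b B) \<le> V (a B)"
      using G by (auto simp: occ_sets_def)
  qed (auto intro!: mult_nonneg_nonneg divide_nonneg_pos sum_nonneg)
  finally show ?thesis .
qed

section \<open>Ground states and the partition function\<close>

text \<open>A minimiser of the energy serves, since exchanging \<open>a\<close> for \<open>b\<close>
  cannot lower its energy.\<close>

lemma ground_state_exists:
  fixes V :: "int \<Rightarrow> real"
  assumes "k \<le> N"
  obtains G where "G \<in> occ_sets N k" "\<And>a b. a \<in> G \<Longrightarrow> b \<in> {1..int N} - G \<Longrightarrow> V a \<le> V b"
proof -
  obtain A where "A \<subseteq> {1..int N}" "card A = k"
    using obtain_subset_with_card_n [of k "{1..int N}"] assms by auto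
  then have "occ_sets N k \<noteq> {}" by (auto simp: occ_sets_def)
  then obtain G where G: "G \<in> occ_sets N k" and min: "\<And>A. A \<in> occ_sets N k \<Longrightarrow> energy V G \<le> energy V A"
    using ex_is_arg_min_if_finite [OF finite_occ_sets, of N k "energy V"]
    by (auto simp: is_arg_min_linorder)
  have "V a \<le> V b" if a: "a \<in> G" and b: "b \<in> {1..int N} - G" for a b
  proof -
    have "energy V G \<le> energy V (insert b (G - {a}))"
      using a b G by (intro min exchange_occ_sets) auto
    also have "\<dots> = V b + (energy V G - V a)"
      using a b finite_occ_set [OF G] by (simp add: energy_def sum_diff1)
    finally show ?thesis by simp
  qed
  with G that show ?thesis by blast
qed

text \<open>Both sets have \<open>k\<close> elements, so the shift by \<open>\<theta>\<close>
  cancels and the relative weight of \<open>A\<close> is a product over its symmetric difference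
  with \<open>G\<close>. That difference determines \<open>A\<close>, and letting it range over all
  subsets of the segment turns the sum into a product.\<close>

lemma partition_function_bound:
  assumes G: "G \<in> occ_sets N k"
    and below: "\<And>x. x \<in> G \<Longrightarrow> V x \<le> \<theta>" and above: "\<And>x. x \<in> {1..int N} - G \<Longrightarrow> \<theta> \<le> V x"
  shows "(\<Sum>A\<in>occ_sets N k. weight V A) / weight V G \<le> (\<Prod>x = 1..int N. 1 + exp (- \<bar>V x - \<theta>\<bar>))"
proof -
  let ?g = "\<lambda>x. exp (- \<bar>V x - \<theta>\<bar>)" and ?d = "\<lambda>A. (A - G) \<union> (G - A)"
  have finG: "finite G" and GN: "G \<subseteq> {1..int N}" using finite_occ_set [OF G] G by (auto simp: occ_sets_def)
  have w: "weight V A / weight V G = (\<Prod>x\<in>?d A. ?g x)" if A: "A \<in> occ_sets N k" for A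
  proof -
    have finA: "finite A" using finite_occ_set [OF A] .
    have E: "energy V B = (\<Sum>x\<in>B. V x - \<theta>) + real k * \<theta>" if "B \<in> occ_sets N k" for B
      using that by (simp add: energy_def sum_subtractf occ_sets_def)
    have "energy V A - energy V G = (\<Sum>x\<in>A. V x - \<theta>) - (\<Sum>x\<in>G. V x - \<theta>)"
      using E [OF A] E [OF G] by simp
    also have "\<dots> = (\<Sum>x\<in>A - G. V x - \<theta>) - (\<Sum>x\<in>G - A. V x - \<theta>)"
      using sum.Int_Diff [OF finA, of "\<lambda>x. V x - \<theta>" G] sum.Int_Diff [OF finG, of "\<lambda>x. V x - \<theta>" A]
      by (simp add: Int_commute)
    also have "(\<Sum>x\<in>A - G. V x - \<theta>) = (\<Sum>x\<in>A - G. \<bar>V x - \<theta>\<bar>)"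
      using A above by (intro sum.cong) (force simp: occ_sets_def)+
    also have "- (\<Sum>x\<in>G - A. V x - \<theta>) = (\<Sum>x\<in>G - A. \<bar>V x - \<theta>\<bar>)"
      unfolding sum_negf [symmetric] using below by (intro sum.cong) (force simp: occ_sets_def)+
    then have "(\<Sum>x\<in>A - G. \<bar>V x - \<theta>\<bar>) - (\<Sum>x\<in>G - A. V x - \<theta>) =
        (\<Sum>x\<in>A - G. \<bar>V x - \<theta>\<bar>) + (\<Sum>x\<in>G - A. \<bar>V x - \<theta>\<bar>)" by simp
    also have "\<dots> = (\<Sum>x\<in>?d A. \<bar>V x - \<theta>\<bar>)"
      using finA finG by (subst sum.union_disjoint) auto
    finally have "energy V G - energy V A = (\<Sum>x\<in>?d A. - \<bar>V x - \<theta>\<bar>)" by (simp add: sum_negf)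
    moreover have "weight V A / weight V G = exp (energy V G - energy V A)"
      by (simp add: weight_def flip: exp_diff)
    ultimately show ?thesis using finA finG by (simp add: exp_sum)
  qed
  have inj: "inj_on ?d (occ_sets N k)"
    by (rule inj_on_inverseI [of _ "\<lambda>D. (D - G) \<union> (G - D)"]) auto
  have "(\<Sum>A\<in>occ_sets N k. weight V A) / weight V G = (\<Sum>A\<in>occ_sets N k. \<Prod>x\<in>?d A. ?g x)"
    using w by (simp add: sum_divide_distrib)
  also have "\<dots> = (\<Sum>D\<in>?d ` occ_sets N k. \<Prod>x\<in>D. ?g x)"
    by (simp add: sum.reindex [OF inj])
  also have "\<dots> \<le> (\<Sum>D\<in>Pow {1..int N}. \<Prod>x\<in>D. ?g x)"
    using GN by (intro sum_mono2 prod_nonneg) (auto simp: occ_sets_def)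
  also have "\<dots> = (\<Prod>x = 1..int N. 1 + ?g x)"
    using prod_add [of "{1..int N}" ?g "\<lambda>_. 1"] by (simp add: add.commute)
  finally show ?thesis .
qed

lemma card_diameter:
  fixes J :: "int set" and q :: real
  assumes "finite J" "0 \<le> q" "\<And>x y. x \<in> J \<Longrightarrow> y \<in> J \<Longrightarrow> x \<le> y \<Longrightarrow> real_of_int (y - x) < q"
  shows "real (card J) \<le> q + 1"
proof (cases "J = {}")
  case False
  have "J \<subseteq> {Min J..<Min J + \<lceil>q\<rceil>}"
  proof
    fix x assume x: "x \<in> J"
    then have "Min J \<le> x" using assms by simp
    moreover from assms(3) [OF Min_in [OF assms(1) False] x this]
    have "x - Min J < \<lceil>q\<rceil>" by linarith
    ultimately show "x \<in> {Min J..<Min J + \<lceil>q\<rceil>}" by simp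
  qed
  then have "card J \<le> card {Min J..<Min J + \<lceil>q\<rceil>}" by (intro card_mono) auto
  then have "card J \<le> nat \<lceil>q\<rceil>" by simp
  then show ?thesis using assms(2) by linarith
qed (use assms in auto)

text \<open>With \<open>\<theta>\<close> the highest potential in \<open>G\<close>, a site whose
  potential is within \<open>s\<close> of \<open>\<theta>\<close> contributes a factor of at most 2,
  any other site at most \<open>exp (exp (- s))\<close>. The assumption \<open>drop\<close> limits
  the number of the former to \<open>2 * q + 2\<close>.\<close>

lemma ground_state_weight_bound:
  assumes G: "G \<in> occ_sets N k" and k: "0 < k"
    and ground: "\<And>a b. a \<in> G \<Longrightarrow> b \<in> {1..int N} - G \<Longrightarrow> V a \<le> V b"
    and q: "0 \<le> q" and drop: "\<And>x y. 1 \<le> x \<Longrightarrow> y \<le> int N \<Longrightarrow> x \<le> y \<Longrightarrow> q \<le> real_of_int (y - x) \<Longrightarrow> V y - V x \<le> - s"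
  shows "(\<Sum>A\<in>occ_sets N k. weight V A) / weight V G \<le> 4 * 4 powr q * exp (real N * exp (- s))"
proof -
  have finG: "finite G" and GN: "G \<subseteq> {1..int N}" and "G \<noteq> {}"
    using finite_occ_set [OF G] G k by (auto simp: occ_sets_def)
  define \<theta> where "\<theta> = Max (V ` G)"
  have below: "V x \<le> \<theta>" if "x \<in> G" for x using that finG by (auto simp: \<theta>_def)
  have above: "\<theta> \<le> V x" if "x \<in> {1..int N} - G" for x
    using that finG \<open>G \<noteq> {}\<close> ground by (auto simp: \<theta>_def)
  let ?g = "\<lambda>x. exp (- \<bar>V x - \<theta>\<bar>)"
  \<comment> \<open>The window is halved because \<open>drop\<close> forces two sites to be closer
    than \<open>q\<close> once their potentials differ by less than \<open>s\<close>.\<close>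
  define J1 J2 where "J1 = {x\<in>{1..int N}. \<theta> \<le> V x \<and> V x < \<theta> + s}"
    and "J2 = {x\<in>{1..int N}. \<theta> - s < V x \<and> V x < \<theta>}"
  let ?J = "J1 \<union> J2"
  have J: "?J \<subseteq> {1..int N}" by (auto simp: J1_def J2_def)
  then have finJ: "finite ?J" by (rule finite_subset) simp
  have card1: "real (card J1) \<le> q + 1"
  proof (rule card_diameter)
    fix x y assume "x \<in> J1" "y \<in> J1" "x \<le> y"
    with drop [of x y] show "real_of_int (y - x) < q" by (force simp: J1_def)
  qed (use q finJ in auto)
  have card2: "real (card J2) \<le> q + 1"
  proof (rule card_diameter)
    fix x y assume "x \<in> J2" "y \<in> J2" "x \<le> y"
    with drop [of x y] show "real_of_int (y - x) < q" by (force simp: J2_def)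
  qed (use q finJ in auto)
  have "(\<Sum>A\<in>occ_sets N k. weight V A) / weight V G \<le> (\<Prod>x = 1..int N. 1 + ?g x)"
    using G below above by (rule partition_function_bound)
  also have "\<dots> = (\<Prod>x\<in>?J. 1 + ?g x) * (\<Prod>x\<in>{1..int N} - ?J. 1 + ?g x)"
    using prod.subset_diff [OF J, of "\<lambda>x. 1 + ?g x"] by (simp add: mult.commute)
  also have "\<dots> \<le> (\<Prod>x\<in>?J. 2) * (\<Prod>x\<in>{1..int N} - ?J. exp (exp (- s)))"
  proof (intro mult_mono prod_mono conjI)
    fix x assume x: "x \<in> {1..int N} - ?J"
    then have "s \<le> \<bar>V x - \<theta>\<bar>" by (force simp: J1_def J2_def)
    then have "?g x \<le> exp (- s)" by simp
    also have "1 + exp (- s) \<le> exp (exp (- s))" by (rule exp_ge_add_one_self)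
    finally show "1 + ?g x \<le> exp (exp (- s))" by simp
  qed (auto intro!: prod_nonneg add_nonneg_nonneg)
  also have "\<dots> \<le> (4 * 4 powr q) * exp (real N * exp (- s))"
  proof (intro mult_mono)
    have "real (card ?J) \<le> 2 * q + 2" using card_Un_le [of J1 J2] card1 card2 by linarith
    then have "2 powr real (card ?J) \<le> 2 powr (2 * q + 2)" by simp
    also have "\<dots> = 4 * 4 powr q" using powr_powr [of 2 2 q] by (simp add: powr_add)
    finally show "(\<Prod>x\<in>?J. 2) \<le> 4 * 4 powr q" by (simp add: powr_realpow)
    have "(\<Prod>x\<in>{1..int N} - ?J. exp (exp (- s))) = exp (real (card ({1..int N} - ?J)) * exp (- s))"
      by (simp add: exp_of_nat_mult)
    also have "card ({1..int N} - ?J) \<le> N"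
      using card_mono [of "{1..int N}" "{1..int N} - ?J"] by simp
    then have "exp (real (card ({1..int N} - ?J)) * exp (- s)) \<le> exp (real N * exp (- s))" by simp
    finally show "(\<Prod>x\<in>{1..int N} - ?J. exp (exp (- s))) \<le> exp (real N * exp (- s))" .
  qed (auto intro!: prod_nonneg)
  finally show ?thesis .
qed

section \<open>Exponential convergence of the exclusion process\<close>

text \<open>The value \<open>undefined\<close> off the segment makes this an extensional function,
  as the elements of \<open>configs\<close> are.\<close>

definition config :: "nat \<Rightarrow> int set \<Rightarrow> int \<Rightarrow> nat" where
  "config N A = (\<lambda>x. if x \<in> {1..int N} then of_bool (x \<in> A) else undefined)"

definition unhop :: "int set \<Rightarrow> int \<Rightarrow> int set" where
  "unhop A x = insert x (A - {x + 1})"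

lemma sum_config:
  assumes "A \<subseteq> {1..int N}"
  shows "(\<Sum>x = 1..int N. c x * real (config N A x)) = (\<Sum>x\<in>A. c x)"
proof -
  have "(\<Sum>x = 1..int N. c x * real (config N A x)) = (\<Sum>x = 1..int N. if x \<in> A then c x else 0)"
    by (intro sum.cong) (auto simp: config_def)
  also have "\<dots> = (\<Sum>x\<in>{1..int N} \<inter> A. c x)" by (simp add: sum.inter_restrict)
  also have "{1..int N} \<inter> A = A" using assms by auto
  finally show ?thesis .
qed

lemma bij_config: "bij_betw (config N) (occ_sets N k) (configs N k)"
proof (rule bij_betw_byWitness [where f' = "\<lambda>\<xi>. {x \<in> {1..int N}. \<xi> x = 1}"])
  show "\<forall>A\<in>occ_sets N k. {x \<in> {1..int N}. config N A x = 1} = A"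
    by (auto simp: occ_sets_def config_def)
  show "\<forall>\<xi>\<in>configs N k. config N {x \<in> {1..int N}. \<xi> x = 1} = \<xi>"
  proof (intro ballI ext)
    fix \<xi> x assume "\<xi> \<in> configs N k"
    then have \<xi>: "\<xi> \<in> {1..int N} \<rightarrow>\<^sub>E {0, 1}" by (simp add: configs_def)
    show "config N {x \<in> {1..int N}. \<xi> x = 1} x = \<xi> x"
      using PiE_mem [OF \<xi>, of x] PiE_arb [OF \<xi>, of x] by (auto simp: config_def)
  qed
  show "config N ` occ_sets N k \<subseteq> configs N k"
  proof
    fix \<xi> assume "\<xi> \<in> config N ` occ_sets N k"
    then obtain A where A: "A \<in> occ_sets N k" "\<xi> = config N A" by auto
    have "real (\<Sum>x = 1..int N. config N A x) = real k"
      using sum_config [of A N "\<lambda>_. 1"] A by (simp add: occ_sets_def)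
    then have "(\<Sum>x = 1..int N. config N A x) = k" by (simp only: of_nat_eq_iff)
    then show "\<xi> \<in> configs N k" using A by (auto simp: configs_def config_def PiE_iff extensional_def)
  qed
  show "(\<lambda>\<xi>. {x \<in> {1..int N}. \<xi> x = 1}) ` configs N k \<subseteq> occ_sets N k"
  proof
    fix A assume "A \<in> (\<lambda>\<xi>. {x \<in> {1..int N}. \<xi> x = 1}) ` configs N k"
    then obtain \<xi> where \<xi>: "\<xi> \<in> configs N k" "A = {x \<in> {1..int N}. \<xi> x = 1}" by auto
    have "card A = (\<Sum>x = 1..int N. if \<xi> x = 1 then 1 else 0)"
      unfolding \<xi>(2) by (simp add: sum.If_cases Int_def)
    also have "\<dots> = (\<Sum>x = 1..int N. \<xi> x)"
      using \<xi>(1) by (intro sum.cong) (auto simp: configs_def PiE_iff)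
    finally show "A \<in> occ_sets N k" using \<xi> by (auto simp: occ_sets_def configs_def)
  qed
qed

lemma finite_configs [simp]: "finite (configs N k)"
  using bij_betw_finite [OF bij_config, of N k] by simp

lemma config_potential_config:
  "A \<in> occ_sets N k \<Longrightarrow> config_potential w N (config N A) = energy (potential w) A"
  using sum_config [of A N "potential w"] by (simp add: config_potential_def energy_def occ_sets_def)

lemma exchange_configs:
  assumes "\<xi> \<in> configs N k" "x \<in> {1..int N - 1}"
  shows "exchange \<xi> x \<in> configs N k"
proof -
  have x: "x \<in> {1..int N}" "x + 1 \<in> {1..int N}" using assms by auto
  have "(\<Sum>y = 1..int N. exchange \<xi> x y) = (\<Sum>y = 1..int N. \<xi> y)"
    using x by (intro sum.reindex_bij_witness [of _ "Transposition.transpose x (x + 1)" "Transposition.transpose x (x + 1)"])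
      (auto simp: exchange_def Transposition.transpose_def)
  then show ?thesis
    using assms(1) x by (auto simp: configs_def exchange_def PiE_iff extensional_def)
qed

section \<open>The generator on sets and its Dirichlet form\<close>

definition set_gen :: "(int \<Rightarrow> real) \<Rightarrow> nat \<Rightarrow> (int set \<Rightarrow> real) \<Rightarrow> int set \<Rightarrow> real" where
  "set_gen w N f A = (\<Sum>x = 1..int N - 1.
     if x \<in> A \<and> x + 1 \<notin> A then w x * (f (hop A x) - f A)
     else if x \<notin> A \<and> x + 1 \<in> A then (1 - w (x + 1)) * (f (unhop A x) - f A) else 0)"

lemma generator_config:
  "generator w N f (config N A) = set_gen w N (\<lambda>B. f (config N B)) A"
  unfolding generator_def set_gen_def
proof (intro sum.cong refl)
  fix x assume x: "x \<in> {1..int N - 1}"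
  have "exchange (config N A) x = config N (hop A x)" if "x \<in> A" "x + 1 \<notin> A"
    using x that by (intro ext) (auto simp: exchange_def config_def hop_def)
  moreover have "exchange (config N A) x = config N (unhop A x)" if "x \<notin> A" "x + 1 \<in> A"
    using x that by (intro ext) (auto simp: exchange_def config_def unhop_def)
  ultimately show "jump_rate w (config N A) x * (f (exchange (config N A) x) - f (config N A)) =
    (if x \<in> A \<and> x + 1 \<notin> A then w x * (f (config N (hop A x)) - f (config N A))
     else if x \<notin> A \<and> x + 1 \<in> A then (1 - w (x + 1)) * (f (config N (unhop A x)) - f (config N A)) else 0)"
    using x by (auto simp: jump_rate_def config_def)
qed

text \<open>Detailed balance at a bond passes to configurations, because a hop replaces a single
  term of the energy.\<close>

lemma weight_hop:
  assumes "finite A" "x \<in> A" "x + 1 \<notin> A" "exp (- V x) * p = exp (- V (x + 1)) * r"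
  shows "weight V (hop A x) * r = weight V A * p"
proof -
  have "energy V (hop A x) = energy V A - V x + V (x + 1)"
    using assms by (simp add: energy_def hop_def sum_diff1)
  then have "weight V (hop A x) = weight V A * exp (V x) * exp (- V (x + 1))"
    by (simp add: weight_def flip: exp_add)
  then have "weight V (hop A x) * r = weight V A * exp (V x) * (exp (- V x) * p)"
    unfolding assms(4) by simp
  then show ?thesis by (simp add: exp_minus)
qed

text \<open>Summation by parts for a reversible chain: jumps to the left are rewritten as reversed
  jumps to the right, with weights matched by detailed balance. A constant \<open>g\<close> yields
  invariance of the equilibrium, and \<open>g\<close> equal to \<open>f\<close> up to a constant
  yields the dissipation of the variance.\<close>

lemma dirichlet_form:
  assumes db: "\<And>x. x \<in> {1..int N - 1} \<Longrightarrow> exp (- V x) * w x = exp (- V (x + 1)) * (1 - w (x + 1))"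
  shows "(\<Sum>A\<in>occ_sets N k. weight V A * (g A * set_gen w N f A)) =
    - (\<Sum>x = 1..int N - 1. \<Sum>A\<in>hoppable N k x. weight V A * w x * ((g (hop A x) - g A) * (f (hop A x) - f A)))"
proof -
  let ?p = "\<lambda>x A. w x * (f (hop A x) - f A)" and ?r = "\<lambda>x A. (1 - w (x + 1)) * (f (unhop A x) - f A)"
  have one: "(\<Sum>A\<in>occ_sets N k. weight V A * g A * (if x \<in> A \<and> x + 1 \<notin> A then ?p x A
      else if x \<notin> A \<and> x + 1 \<in> A then ?r x A else 0)) =
    - (\<Sum>A\<in>hoppable N k x. weight V A * w x * ((g (hop A x) - g A) * (f (hop A x) - f A)))"
    if x: "x \<in> {1..int N - 1}" for x
  proof -
    let ?H' = "{A \<in> occ_sets N k. x \<notin> A \<and> x + 1 \<in> A}"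
    have "(\<Sum>A\<in>occ_sets N k. weight V A * g A * (if x \<in> A \<and> x + 1 \<notin> A then ?p x A
      else if x \<notin> A \<and> x + 1 \<in> A then ?r x A else 0)) =
      (\<Sum>A\<in>occ_sets N k. (if x \<in> A \<and> x + 1 \<notin> A then weight V A * g A * ?p x A else 0) +
         (if x \<notin> A \<and> x + 1 \<in> A then weight V A * g A * ?r x A else 0))"
      by (intro sum.cong) auto
    also have "\<dots> = (\<Sum>A\<in>hoppable N k x. weight V A * g A * ?p x A) + (\<Sum>A\<in>?H'. weight V A * g A * ?r x A)"
      by (simp add: sum.distrib hoppable_def flip: sum.inter_filter)
    also have "(\<Sum>A\<in>?H'. weight V A * g A * ?r x A) =
        (\<Sum>A\<in>hoppable N k x. weight V A * w x * (g (hop A x) * (f A - f (hop A x))))"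
    proof (intro sum.reindex_bij_witness [of _ "\<lambda>A. hop A x" "\<lambda>A. unhop A x"])
      fix A assume A: "A \<in> ?H'"
      show un: "hop (unhop A x) x = A" using A by (auto simp: hop_def unhop_def)
      have "unhop A x \<in> occ_sets N k"
        unfolding unhop_def using A x by (intro exchange_occ_sets) auto
      then show U: "unhop A x \<in> hoppable N k x" using A by (auto simp: hoppable_def unhop_def)
      have "weight V (hop (unhop A x) x) * (1 - w (x + 1)) = weight V (unhop A x) * w x"
        using U finite_occ_set by (intro weight_hop db x) (auto simp: hoppable_def)
      then have "weight V A * (1 - w (x + 1)) = weight V (unhop A x) * w x" unfolding un .
      then show "weight V (unhop A x) * w x * (g (hop (unhop A x) x) * (f (unhop A x) - f (hop (unhop A x) x))) =
          weight V A * g A * ?r x A"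
        unfolding un by (metis (no_types) mult.assoc mult.commute)
    next
      fix A assume A: "A \<in> hoppable N k x"
      show "unhop (hop A x) x = A" using A by (auto simp: hop_def unhop_def hoppable_def)
      have "hop A x \<in> occ_sets N k"
        unfolding hop_def using A x by (intro exchange_occ_sets) (auto simp: hoppable_def)
      then show "hop A x \<in> ?H'" using A by (auto simp: hoppable_def hop_def)
    qed
    finally show ?thesis by (simp add: algebra_simps flip: sum.distrib sum_negf)
  qed
  have "(\<Sum>A\<in>occ_sets N k. weight V A * (g A * set_gen w N f A)) =
    (\<Sum>A\<in>occ_sets N k. \<Sum>x = 1..int N - 1. weight V A * g A * (if x \<in> A \<and> x + 1 \<notin> A then ?p x A
      else if x \<notin> A \<and> x + 1 \<in> A then ?r x A else 0))"
    by (simp add: set_gen_def sum_distrib_left mult.assoc)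
  also have "\<dots> = (\<Sum>x = 1..int N - 1. \<Sum>A\<in>occ_sets N k. weight V A * g A * (if x \<in> A \<and> x + 1 \<notin> A then ?p x A
      else if x \<notin> A \<and> x + 1 \<in> A then ?r x A else 0))"
    by (rule sum.swap)
  finally show ?thesis by (simp add: one sum_negf)
qed

section \<open>The semigroup as a convergent power series\<close>

text \<open>An operator norm bound for the supremum norm on \<open>configs N k\<close>, crude but
  enough to dominate the power series by an exponential one.\<close>

lemma generator_bound:
  assumes "\<And>\<eta>. \<eta> \<in> configs N k \<Longrightarrow> \<bar>f \<eta>\<bar> \<le> B" "\<xi> \<in> configs N k"
  shows "\<bar>generator w N f \<xi>\<bar> \<le> (\<Sum>x = 1..int N - 1. 2 * (\<bar>w x\<bar> + \<bar>1 - w (x + 1)\<bar>)) * B"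
proof -
  have "\<bar>generator w N f \<xi>\<bar> \<le> (\<Sum>x = 1..int N - 1. \<bar>jump_rate w \<xi> x * (f (exchange \<xi> x) - f \<xi>)\<bar>)"
    unfolding generator_def by (rule sum_abs)
  also have "\<dots> \<le> (\<Sum>x = 1..int N - 1. (\<bar>w x\<bar> + \<bar>1 - w (x + 1)\<bar>) * (2 * B))"
  proof (rule sum_mono)
    fix x assume x: "x \<in> {1..int N - 1}"
    have "\<bar>f (exchange \<xi> x) - f \<xi>\<bar> \<le> 2 * B"
      using assms(1) [OF exchange_configs [OF assms(2) x]] assms(1) [OF assms(2)] by linarith
    moreover have "\<bar>jump_rate w \<xi> x\<bar> \<le> \<bar>w x\<bar> + \<bar>1 - w (x + 1)\<bar>"
      by (auto simp: jump_rate_def)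
    ultimately show "\<bar>jump_rate w \<xi> x * (f (exchange \<xi> x) - f \<xi>)\<bar> \<le> (\<bar>w x\<bar> + \<bar>1 - w (x + 1)\<bar>) * (2 * B)"
      unfolding abs_mult by (intro mult_mono) auto
  qed
  finally show ?thesis by (simp add: sum_distrib_left sum_distrib_right mult_ac)
qed

lemma summable_semigroup:
  assumes "\<xi> \<in> configs N k"
  shows "summable (\<lambda>n. (generator w N ^^ n) f \<xi> / fact n * t ^ n)"
proof -
  define C where "C = (\<Sum>x = 1..int N - 1. 2 * (\<bar>w x\<bar> + \<bar>1 - w (x + 1)\<bar>))"
  define B where "B = (MAX \<eta>\<in>configs N k. \<bar>f \<eta>\<bar>)"
  have bound: "\<bar>(generator w N ^^ n) f \<eta>\<bar> \<le> C ^ n * B" if "\<eta> \<in> configs N k" for n \<eta>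
    using that
  proof (induction n arbitrary: \<eta>)
    case (Suc n)
    have "\<bar>generator w N ((generator w N ^^ n) f) \<eta>\<bar> \<le> C * (C ^ n * B)"
      unfolding C_def using Suc by (intro generator_bound [where k = k]) (auto simp: C_def)
    then show ?case by (simp add: mult.assoc)
  qed (auto simp: B_def)
  have "summable (\<lambda>n. B * ((C * \<bar>t\<bar>) ^ n /\<^sub>R fact n))"
    by (intro summable_mult summable_exp_generic)
  then show ?thesis
  proof (rule summable_comparison_test')
    fix n :: nat
    have "norm ((generator w N ^^ n) f \<xi> / fact n * t ^ n) = \<bar>(generator w N ^^ n) f \<xi>\<bar> * (\<bar>t\<bar> ^ n / fact n)"
      by (simp add: abs_mult power_abs)
    also have "\<dots> \<le> (C ^ n * B) * (\<bar>t\<bar> ^ n / fact n)"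
      using bound [OF assms] by (intro mult_right_mono) auto
    finally show "norm ((generator w N ^^ n) f \<xi> / fact n * t ^ n) \<le> B * ((C * \<bar>t\<bar>) ^ n /\<^sub>R fact n)"
      by (simp add: power_mult_distrib field_simps)
  qed
qed

lemma semigroup_eq: "semigroup w N t f \<xi> = (\<Sum>n. (generator w N ^^ n) f \<xi> / fact n * t ^ n)"
  unfolding semigroup_def by (intro arg_cong [of _ _ suminf]) (auto simp: field_simps)

lemma semigroup_0: "semigroup w N 0 f \<xi> = f \<xi>"
  using powser_zero [of "\<lambda>n. (generator w N ^^ n) f \<xi> / fact n"] by (simp add: semigroup_eq)

text \<open>The backward equation, by termwise differentiation: the generator at
  \<open>\<xi>\<close> is a finite combination of values, so it acts on the series coefficient by
  coefficient and shifts the iterates by one.\<close>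

lemma semigroup_deriv:
  assumes \<xi>: "\<xi> \<in> configs N k"
  shows "((\<lambda>t. semigroup w N t f \<xi>) has_real_derivative generator w N (semigroup w N t f) \<xi>) (at t)"
proof -
  let ?c = "\<lambda>\<eta> n. (generator w N ^^ n) f \<eta> / fact n"
  have sums: "(\<lambda>n. ?c \<eta> n * t ^ n) sums semigroup w N t f \<eta>" if "\<eta> \<in> configs N k" for \<eta>
    unfolding semigroup_eq by (intro summable_sums summable_semigroup [OF that])
  have "(\<lambda>n. \<Sum>x = 1..int N - 1. jump_rate w \<xi> x * (?c (exchange \<xi> x) n * t ^ n - ?c \<xi> n * t ^ n)) sums
      generator w N (semigroup w N t f) \<xi>"
    unfolding generator_def [of w N "semigroup w N t f"]
    by (intro sums_sum sums_mult sums_diff sums exchange_configs \<xi>)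
  also have "(\<lambda>n. \<Sum>x = 1..int N - 1. jump_rate w \<xi> x * (?c (exchange \<xi> x) n * t ^ n - ?c \<xi> n * t ^ n)) =
      (\<lambda>n. diffs (?c \<xi>) n * t ^ n)"
  proof
    fix n
    have "diffs (?c \<xi>) n = generator w N ((generator w N ^^ n) f) \<xi> / fact n"
      by (simp add: diffs_def del: of_nat_Suc)
    then show "(\<Sum>x = 1..int N - 1. jump_rate w \<xi> x * (?c (exchange \<xi> x) n * t ^ n - ?c \<xi> n * t ^ n)) =
      diffs (?c \<xi>) n * t ^ n"
      unfolding generator_def [of w N "(generator w N ^^ n) f"]
      by (simp only: sum_divide_distrib sum_distrib_right) (intro sum.cong refl, simp add: algebra_simps diff_divide_distrib)
  qed
  finally have "(\<Sum>n. diffs (?c \<xi>) n * t ^ n) = generator w N (semigroup w N t f) \<xi>"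
    by (rule sums_unique [symmetric])
  moreover have "((\<lambda>t. \<Sum>n. ?c \<xi> n * t ^ n) has_real_derivative (\<Sum>n. diffs (?c \<xi>) n * t ^ n)) (at t)"
    by (intro termdiffs_strong_converges_everywhere summable_semigroup [OF \<xi>])
  ultimately show ?thesis by (simp add: semigroup_eq [abs_def])
qed

lemma continuous_law_at: "\<xi> \<in> configs N k \<Longrightarrow> continuous_on UNIV (\<lambda>t. law_at w N t \<xi> A)"
  unfolding law_at_def
  by (rule DERIV_continuous_on [OF has_field_derivative_at_within [OF semigroup_deriv]])

text \<open>Maximum and supremum both range over finite sets, which leaves finitely many
  inequalities between functions continuous in \<open>t\<close>.\<close>

lemma max_dist_le_iff:
  assumes "configs N k \<noteq> {}"
  shows "max_dist w N k t \<le> r \<longleftrightarrow>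
    (\<forall>\<xi>\<in>configs N k. \<forall>A\<in>Pow (configs N k). \<bar>law_at w N t \<xi> A - equilibrium w N k A\<bar> \<le> r)"
proof -
  have "tv_dist (configs N k) \<mu> \<nu> \<le> r \<longleftrightarrow> (\<forall>A\<in>Pow (configs N k). \<bar>\<mu> A - \<nu> A\<bar> \<le> r)" for \<mu> \<nu>
    unfolding tv_dist_def by (subst cSUP_le_iff) (auto simp: bdd_above_finite)
  then show ?thesis using assms by (simp add: max_dist_def)
qed

lemma config_in_configs: "A \<in> occ_sets N k \<Longrightarrow> config N A \<in> configs N k"
  by (rule bij_betwE [OF bij_config, rule_format])

lemma configs_nonempty:
  assumes "k \<le> N"
  shows "configs N k \<noteq> {}"
proof -
  obtain G where "G \<in> occ_sets N k" by (rule ground_state_exists [OF assms, of "\<lambda>_. 0"])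
  then show ?thesis using config_in_configs by auto
qed

lemma sum_configs: "(\<Sum>\<xi>\<in>configs N k. f \<xi>) = (\<Sum>A\<in>occ_sets N k. f (config N A))"
  by (rule sum.reindex_bij_betw [OF bij_config, symmetric])

section \<open>Decay of the variance\<close>

text \<open>The two sides differ by the total weight times \<open>(m - c)\<^sup>2\<close>. For
  \<open>c\<close> the value at the reference state and the value 0 are taken later.\<close>

lemma weighted_mean_minimises:
  fixes W u :: "'b \<Rightarrow> real"
  assumes "(\<Sum>A\<in>S. W A * u A) = m * (\<Sum>A\<in>S. W A)" "\<And>A. A \<in> S \<Longrightarrow> 0 \<le> W A"
  shows "(\<Sum>A\<in>S. W A * (u A - m)\<^sup>2) \<le> (\<Sum>A\<in>S. W A * (u A - c)\<^sup>2)"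
proof -
  have "(\<Sum>A\<in>S. W A * (u A - c)\<^sup>2) - (\<Sum>A\<in>S. W A * (u A - m)\<^sup>2) =
      (\<Sum>A\<in>S. W A * u A * (2 * (m - c)) + W A * (c\<^sup>2 - m\<^sup>2))"
    unfolding sum_subtractf [symmetric] by (intro sum.cong) (auto simp: algebra_simps power2_eq_square)
  also have "\<dots> = (m * (\<Sum>A\<in>S. W A)) * (2 * (m - c)) + (\<Sum>A\<in>S. W A) * (c\<^sup>2 - m\<^sup>2)"
    unfolding assms(1) [symmetric] by (simp add: sum.distrib sum_distrib_right)
  also have "\<dots> = (\<Sum>A\<in>S. W A) * (m - c)\<^sup>2" by (simp add: algebra_simps power2_eq_square)
  also have "\<dots> \<ge> 0" using assms(2) by (intro mult_nonneg_nonneg sum_nonneg) auto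
  finally show ?thesis by simp
qed

text \<open>Gronwall's argument: the product of \<open>v t\<close> with the integrating factor
  \<open>exp (c * t)\<close> does not increase.\<close>

lemma exponential_decay:
  fixes v v' :: "real \<Rightarrow> real"
  assumes deriv: "\<And>t. (v has_real_derivative v' t) (at t)" and le: "\<And>t. v' t \<le> - c * v t" and "0 \<le> t"
  shows "v t \<le> v 0 * exp (- c * t)"
proof -
  have "exp (c * t) * v t \<le> exp (c * 0) * v 0"
  proof (rule DERIV_nonpos_imp_nonincreasing [OF \<open>0 \<le> t\<close>])
    fix s :: real
    have "((\<lambda>s. exp (c * s) * v s) has_real_derivative exp (c * s) * c * v s + exp (c * s) * v' s) (at s)"
      using deriv [of s] by (auto intro!: derivative_eq_intros)
    moreover have "exp (c * s) * c * v s + exp (c * s) * v' s = exp (c * s) * (v' s - (- c * v s))"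
      by (simp add: algebra_simps)
    moreover have "\<dots> \<le> 0" using le [of s] by (simp add: mult_le_0_iff)
    ultimately show "\<exists>y. ((\<lambda>s. exp (c * s) * v s) has_real_derivative y) (at s) \<and> y \<le> 0" by metis
  qed
  then show ?thesis by (simp add: exp_minus field_simps)
qed

text \<open>A Poincare inequality relative to an arbitrary reference state \<open>G\<close>, instead of the mean, suffices.\<close>

lemma law_at_convergence:
  fixes w :: "int \<Rightarrow> real" and V :: "int \<Rightarrow> real"
  defines "V \<equiv> potential w"
  assumes w: "\<And>x. x \<in> {1..int N} \<Longrightarrow> 0 < w x \<and> w x < 1" "\<And>x. x \<in> {1..int N} \<Longrightarrow> \<alpha> \<le> w x"
    and K: "0 < K" and poincare: "\<And>f. (\<Sum>A\<in>occ_sets N k. weight V A * (f A - f G)\<^sup>2) \<le> K * hop_energy V N k f"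
    and \<alpha>: "0 < \<alpha>" and A: "A \<in> occ_sets N k" and E: "E \<subseteq> configs N k" and t: "0 \<le> t"
  shows "(law_at w N t (config N A) E - equilibrium w N k E)\<^sup>2 \<le>
    (\<Sum>B\<in>occ_sets N k. weight V B) / weight V A * exp (- (2 * \<alpha> / K * t))"
proof -
  let ?\<Omega> = "occ_sets N k"
  \<comment> \<open>Detailed balance: the increment of the potential over a bond is the logarithm of
    the ratio of the two jump rates.\<close>
  have db: "exp (- V x) * w x = exp (- V (x + 1)) * (1 - w (x + 1))" if x: "x \<in> {1..int N - 1}" for x
  proof -
    have "{2..x + 1} = insert (x + 1) {2..x}" using x by auto
    then have "V (x + 1) = V x + ln ((1 - w (x + 1)) / w x)"
      by (simp add: V_def potential_def)
    moreover have "0 < w x" "0 < 1 - w (x + 1)" using w(1) [of x] w(1) [of "x + 1"] x by auto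
    ultimately have "exp (V (x + 1)) = exp (V x) * ((1 - w (x + 1)) / w x)"
      by (simp add: exp_add)
    then show ?thesis using \<open>0 < w x\<close> by (simp add: exp_minus field_simps)
  qed
  define u where "u t B = semigroup w N t (indicator E) (config N B)" for t B
  have u_deriv: "((\<lambda>t. u t B) has_real_derivative set_gen w N (u t) B) (at t)" if "B \<in> ?\<Omega>" for B t
    using semigroup_deriv [OF config_in_configs [OF that], of w "indicator E" t]
    by (simp add: u_def [abs_def] generator_config)
  have u0: "u 0 B = indicator E (config N B)" for B by (simp add: u_def semigroup_0)
  define Z where "Z = (\<Sum>B\<in>?\<Omega>. weight V B)"
  have Z: "0 < Z" unfolding Z_def using A by (intro sum_pos) auto
  define m where "m = equilibrium w N k E"
  have pot: "exp (- config_potential w N (config N B)) = weight V B" if "B \<in> ?\<Omega>" for B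
    using config_potential_config [OF that] by (simp add: weight_def V_def)
  have mean0: "(\<Sum>B\<in>?\<Omega>. weight V B * u 0 B) = m * Z"
  proof -
    have "(\<Sum>\<xi>\<in>E \<inter> configs N k. exp (- config_potential w N \<xi>)) =
        (\<Sum>\<xi>\<in>configs N k. exp (- config_potential w N \<xi>) * indicator E \<xi>)"
      by (intro sum.mono_neutral_cong_left) (auto simp: indicator_def)
    also have "\<dots> = (\<Sum>B\<in>?\<Omega>. weight V B * u 0 B)"
      unfolding sum_configs by (intro sum.cong) (auto simp: pot u0)
    finally show ?thesis
      using Z by (simp add: m_def equilibrium_def sum_configs pot flip: Z_def cong: sum.cong)
  qed
  \<comment> \<open>The mean under the equilibrium is conserved, as its derivative is a Dirichlet
    form paired with a constant.\<close>
  have mean: "(\<Sum>B\<in>?\<Omega>. weight V B * u t B) = m * Z" for t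
  proof -
    have "((\<lambda>t. \<Sum>B\<in>?\<Omega>. weight V B * u t B) has_real_derivative
        (\<Sum>B\<in>?\<Omega>. weight V B * set_gen w N (u t) B)) (at t)" for t
      by (intro DERIV_sum DERIV_cmult u_deriv)
    moreover have "(\<Sum>B\<in>?\<Omega>. weight V B * set_gen w N (u t) B) = 0" for t
      using dirichlet_form [of N V w, OF db, where g = "\<lambda>_. 1"] by simp
    ultimately have "\<forall>t. ((\<lambda>t. \<Sum>B\<in>?\<Omega>. weight V B * u t B) has_real_derivative 0) (at t)"
      by simp
    then have "(\<Sum>B\<in>?\<Omega>. weight V B * u t B) = (\<Sum>B\<in>?\<Omega>. weight V B * u 0 B)"
      by (rule DERIV_isconst_all)
    with mean0 show ?thesis by simp
  qed
  \<comment> \<open>This is \<open>Z\<close> times the variance of \<open>u t\<close> under the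
    equilibrium.\<close>
  define v where "v t = (\<Sum>B\<in>?\<Omega>. weight V B * (u t B - m)\<^sup>2)" for t
  have v_deriv: "(v has_real_derivative 2 * (\<Sum>B\<in>?\<Omega>. weight V B * ((u t B - m) * set_gen w N (u t) B))) (at t)" for t
  proof -
    have "((\<lambda>t. \<Sum>B\<in>?\<Omega>. weight V B * (u t B - m)\<^sup>2) has_real_derivative
        (\<Sum>B\<in>?\<Omega>. weight V B * (2 * (u t B - m) * set_gen w N (u t) B))) (at t)"
      by (intro DERIV_sum DERIV_cmult) (auto intro!: derivative_eq_intros u_deriv)
    also have "(\<Sum>B\<in>?\<Omega>. weight V B * (2 * (u t B - m) * set_gen w N (u t) B)) =
        2 * (\<Sum>B\<in>?\<Omega>. weight V B * ((u t B - m) * set_gen w N (u t) B))"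
      unfolding sum_distrib_left by (intro sum.cong) auto
    finally show ?thesis by (simp add: v_def [abs_def])
  qed
  have v_le: "2 * (\<Sum>B\<in>?\<Omega>. weight V B * ((u t B - m) * set_gen w N (u t) B)) \<le> - (2 * \<alpha> / K) * v t" for t
  proof -
    have "v t \<le> (\<Sum>B\<in>?\<Omega>. weight V B * (u t B - u t G)\<^sup>2)"
      unfolding v_def using mean [of t] by (intro weighted_mean_minimises) (auto simp: Z_def)
    also have "\<dots> \<le> K * hop_energy V N k (u t)" by (rule poincare)
    finally have "v t / K \<le> hop_energy V N k (u t)" using K by (simp add: field_simps)
    then have "\<alpha> * (v t / K) \<le> \<alpha> * hop_energy V N k (u t)" using \<alpha> by (intro mult_left_mono) auto
    also have "\<dots> \<le> (\<Sum>x = 1..int N - 1. \<Sum>B\<in>hoppable N k x.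
        weight V B * w x * ((u t (hop B x) - u t B) * (u t (hop B x) - u t B)))"
      unfolding hop_energy_def sum_distrib_left
    proof (intro sum_mono)
      fix x B assume "x \<in> {1..int N - 1}"
      then have "\<alpha> * (weight V B * (u t (hop B x) - u t B)\<^sup>2) \<le> w x * (weight V B * (u t (hop B x) - u t B)\<^sup>2)"
        using w(2) [of x] by (intro mult_right_mono) auto
      then show "\<alpha> * (weight V B * (u t (hop B x) - u t B)\<^sup>2) \<le>
          weight V B * w x * ((u t (hop B x) - u t B) * (u t (hop B x) - u t B))"
        by (simp add: power2_eq_square mult_ac)
    qed
    also have "\<dots> = - (\<Sum>B\<in>?\<Omega>. weight V B * ((u t B - m) * set_gen w N (u t) B))"
      using dirichlet_form [of N V w, OF db, where g = "\<lambda>B. u t B - m" and f = "u t"] by simp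
    finally show ?thesis by simp
  qed
  \<comment> \<open>A single term of the variance controls the deviation at \<open>A\<close>; the
    division by \<open>weight V A\<close> is the price of a pointwise bound.\<close>
  have "weight V A * (u t A - m)\<^sup>2 \<le> v t"
    unfolding v_def using A by (intro member_le_sum) auto
  also have "\<dots> \<le> v 0 * exp (- (2 * \<alpha> / K) * t)"
    by (rule exponential_decay [OF v_deriv v_le t])
  also have "\<dots> \<le> Z * exp (- (2 * \<alpha> / K) * t)"
  proof (rule mult_right_mono)
    \<comment> \<open>At time 0 the second moment about 0 is at most \<open>Z\<close>, because
      \<open>u 0\<close> takes only the values 0 and 1.\<close>
    have "v 0 \<le> (\<Sum>B\<in>?\<Omega>. weight V B * (u 0 B - 0)\<^sup>2)"
      unfolding v_def using mean [of 0] by (intro weighted_mean_minimises) (auto simp: Z_def)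
    also have "\<dots> \<le> Z" unfolding Z_def
      by (intro sum_mono) (auto simp: u0 indicator_def)
    finally show "v 0 \<le> Z" .
  qed simp
  finally show ?thesis
    by (simp add: field_simps u_def m_def law_at_def Z_def)
qed

section \<open>The mixing time in a fixed environment\<close>

text \<open>Each increment of the potential is
  \<open>ln (rho (w y)) + ln (w y) - ln (w (y - 1))\<close>, and the correction telescopes to a
  boundary term.\<close>

lemma potential_diff:
  assumes w: "\<And>z. z \<in> {1..int N} \<Longrightarrow> 0 < w z \<and> w z < 1" and x: "1 \<le> x" "x \<le> y" "y \<le> int N"
  shows "potential w y - potential w x = (\<Sum>z = x + 1..y. ln (rho (w z))) + (ln (w y) - ln (w x))"
  using x(2,3)
proof (induction y rule: int_ge_induct)
  case (step y)
  have "{2..y + 1} = insert (y + 1) {2..y}" "{x + 1..y + 1} = insert (y + 1) {x + 1..y}"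
    using step.hyps x by auto
  moreover have "0 < w y" "0 < w (y + 1)" "w (y + 1) < 1"
    using w [of y] w [of "y + 1"] step x by auto
  ultimately show ?case
    using step.IH step.prems by (simp add: potential_def rho_def ln_div)
qed simp

lemma abs_ln_ratio_le:
  fixes \<alpha> :: real
  assumes "0 < \<alpha>" "\<alpha> \<le> p" "p \<le> 1 - \<alpha>" "\<alpha> \<le> r" "r \<le> 1 - \<alpha>"
  shows "\<bar>ln p - ln r\<bar> \<le> ln ((1 - \<alpha>) / \<alpha>)"
proof -
  have "ln \<alpha> \<le> ln p" "ln p \<le> ln (1 - \<alpha>)" "ln \<alpha> \<le> ln r" "ln r \<le> ln (1 - \<alpha>)"
    using assms by (auto intro!: ln_mono)
  moreover have "ln ((1 - \<alpha>) / \<alpha>) = ln (1 - \<alpha>) - ln \<alpha>" using assms by (simp add: ln_div)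
  ultimately show ?thesis by linarith
qed

lemma abs_potential_le:
  assumes w: "\<And>z. z \<in> {1..int N} \<Longrightarrow> \<alpha> \<le> w z \<and> w z \<le> 1 - \<alpha>" and "0 < \<alpha>" "\<alpha> < 1 / 2"
    and x: "x \<in> {1..int N}"
  shows "\<bar>potential w x\<bar> \<le> real N * ln ((1 - \<alpha>) / \<alpha>)"
proof -
  have "\<bar>potential w x\<bar> \<le> (\<Sum>y = 2..x. \<bar>ln ((1 - w y) / w (y - 1))\<bar>)"
    unfolding potential_def by (rule sum_abs)
  also have "\<dots> \<le> (\<Sum>y = 2..x. ln ((1 - \<alpha>) / \<alpha>))"
  proof (rule sum_mono)
    fix y assume "y \<in> {2..x}"
    then have y: "\<alpha> \<le> w y" "w y \<le> 1 - \<alpha>" "\<alpha> \<le> w (y - 1)" "w (y - 1) \<le> 1 - \<alpha>"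
      using w [of y] w [of "y - 1"] x by auto
    then have "ln ((1 - w y) / w (y - 1)) = ln (1 - w y) - ln (w (y - 1))"
      using assms(2,3) by (simp add: ln_div)
    then show "\<bar>ln ((1 - w y) / w (y - 1))\<bar> \<le> ln ((1 - \<alpha>) / \<alpha>)"
      using abs_ln_ratio_le [of \<alpha> "1 - w y" "w (y - 1)"] y assms(2) by simp
  qed
  also have "\<dots> = real (card {2..x}) * ln ((1 - \<alpha>) / \<alpha>)" by simp
  also have "\<dots> \<le> real N * ln ((1 - \<alpha>) / \<alpha>)"
    using x assms(2,3) by (intro mult_right_mono ln_ge_zero) auto
  finally show ?thesis .
qed

text \<open>An a priori bound on the inverse equilibrium probability of a configuration. It enters
  the mixing time only through its logarithm, so counting the sets and bounding their energies
  trivially is good enough.\<close>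

lemma partition_ratio_le:
  assumes V: "\<And>x. x \<in> {1..int N} \<Longrightarrow> \<bar>V x\<bar> \<le> D" and A: "A \<in> occ_sets N k" and k: "k \<le> N" "0 < N"
  shows "(\<Sum>B\<in>occ_sets N k. weight V B) / weight V A \<le> exp (real k * ln (real N) + 2 * real k * D)"
proof -
  have E: "\<bar>energy V B\<bar> \<le> real k * D" if "B \<in> occ_sets N k" for B
  proof -
    have "\<bar>energy V B\<bar> \<le> (\<Sum>x\<in>B. \<bar>V x\<bar>)" unfolding energy_def by (rule sum_abs)
    also have "\<dots> \<le> (\<Sum>x\<in>B. D)" using that V by (intro sum_mono) (auto simp: occ_sets_def)
    also have "\<dots> = real k * D" using that by (simp add: occ_sets_def)
    finally show ?thesis .
  qed
  have "(\<Sum>B\<in>occ_sets N k. weight V B) / weight V A = (\<Sum>B\<in>occ_sets N k. exp (energy V A - energy V B))"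
    by (simp add: sum_divide_distrib weight_def flip: exp_diff)
  also have "\<dots> \<le> (\<Sum>B\<in>occ_sets N k. exp (2 * real k * D))"
  proof (intro sum_mono)
    fix B assume "B \<in> occ_sets N k"
    with E [OF A] E [of B] show "exp (energy V A - energy V B) \<le> exp (2 * real k * D)" by simp
  qed
  also have "\<dots> = real (N choose k) * exp (2 * real k * D)"
    using n_subsets [of "{1..int N}" k] by (simp add: occ_sets_def)
  also have "real (N choose k) \<le> real (N ^ k)" using binomial_le_pow [OF k(1)] by (simp only: of_nat_le_iff)
  also have "real (N ^ k) = exp (real k * ln (real N))"
    using k by (simp add: exp_of_nat_mult)
  finally show ?thesis by (simp add: exp_add)
qed

text \<open>The Poincare constant \<open>K\<close> makes squared deviations decay at rate
  \<open>2 * \<alpha> / K\<close>, and the time is chosen so that this decay offsets the a priori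
  ratio. Each \<open>L\<close> added to \<open>h\<close> or subtracted from \<open>s\<close> pays
  for the boundary term in the potential.\<close>

theorem t_mix_bound:
  fixes w :: "int \<Rightarrow> real" and \<alpha> h q s :: real
  defines "L \<equiv> ln ((1 - \<alpha>) / \<alpha>)"
  assumes k: "0 < k" "k \<le> N" and \<alpha>: "0 < \<alpha>" "\<alpha> < 1 / 2"
    and w: "\<And>z. z \<in> {1..int N} \<Longrightarrow> \<alpha> \<le> w z \<and> w z \<le> 1 - \<alpha>"
    and h: "\<And>x y. 1 \<le> x \<Longrightarrow> x \<le> y \<Longrightarrow> y \<le> int N \<Longrightarrow> (\<Sum>z = x + 1..y. ln (rho (w z))) \<le> h"
    and drop: "\<And>x y. 1 \<le> x \<Longrightarrow> x \<le> y \<Longrightarrow> y \<le> int N \<Longrightarrow> q \<le> real_of_int (y - x) \<Longrightarrow>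
      (\<Sum>z = x + 1..y. ln (rho (w z))) \<le> - s"
    and q: "0 \<le> q"
  shows "t_mix w N k \<le> ereal (real k * (4 * 4 powr q * exp (real N * exp (L - s))) *
      (real N ^ 4 * exp (3 * (h + L))) / (2 * \<alpha>) * (ln 16 + real k * ln (real N) + 2 * real k * (real N * L)))"
proof -
  let ?V = "potential w"
  define K where "K = real k * (4 * 4 powr q * exp (real N * exp (L - s))) * (real N ^ 4 * exp (3 * (h + L)))"
  \<comment> \<open>The term \<open>ln 16\<close> brings the squared deviation down to
    \<open>(1 / 4)\<^sup>2\<close>; the rest is the logarithm of the a priori bound.\<close>
  define X where "X = ln 16 + real k * ln (real N) + 2 * real k * (real N * L)"
  have N: "0 < N" using k by simp
  have K: "0 < K" unfolding K_def using k N by (intro mult_pos_pos) auto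
  have L: "0 \<le> L" unfolding L_def using \<alpha> by (intro ln_ge_zero) auto
  have X: "0 \<le> X" unfolding X_def using L N by (intro add_nonneg_nonneg mult_nonneg_nonneg ln_ge_zero) auto
  have w01: "0 < w z \<and> w z < 1" if "z \<in> {1..int N}" for z using w [OF that] \<alpha> by auto
  have corr: "\<bar>ln (w y) - ln (w x)\<bar> \<le> L" if "x \<in> {1..int N}" "y \<in> {1..int N}" for x y
    unfolding L_def using w [OF that(1)] w [OF that(2)] \<alpha> by (intro abs_ln_ratio_le) auto
  obtain G where G: "G \<in> occ_sets N k"
    and ground: "\<And>a b. a \<in> G \<Longrightarrow> b \<in> {1..int N} - G \<Longrightarrow> ?V a \<le> ?V b"
    using ground_state_exists [OF k(2)] by metis
  have Vh: "?V y - ?V x \<le> h + L" if "1 \<le> x" "x \<le> y" "y \<le> int N" for x y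
  proof -
    have "?V y - ?V x = (\<Sum>z = x + 1..y. ln (rho (w z))) + (ln (w y) - ln (w x))"
      using that by (intro potential_diff w01)
    with h [OF that] corr [of x y] that show ?thesis by force
  qed
  have Vdrop: "?V y - ?V x \<le> - (s - L)" if "1 \<le> x" "y \<le> int N" "x \<le> y" "q \<le> real_of_int (y - x)" for x y
  proof -
    have "?V y - ?V x = (\<Sum>z = x + 1..y. ln (rho (w z))) + (ln (w y) - ln (w x))"
      using that by (intro potential_diff w01)
    with drop [OF that(1,3,2,4)] corr [of x y] that show ?thesis by force
  qed
  have poincare: "(\<Sum>A\<in>occ_sets N k. weight ?V A * (f A - f G)\<^sup>2) \<le> K * hop_energy ?V N k f" for f
  proof -
    have "0 \<le> hop_energy ?V N k f"
      unfolding hop_energy_def by (intro sum_nonneg mult_nonneg_nonneg) auto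
    then have "real k * ((\<Sum>A\<in>occ_sets N k. weight ?V A) / weight ?V G) *
        (real N ^ 4 * exp (3 * (h + L)) * hop_energy ?V N k f) \<le>
      real k * (4 * 4 powr q * exp (real N * exp (- (s - L)))) *
        (real N ^ 4 * exp (3 * (h + L)) * hop_energy ?V N k f)"
      using ground_state_weight_bound [where V = ?V, OF G k(1) ground q Vdrop]
      by (intro mult_right_mono mult_left_mono) auto
    with poincare_ground_state [where V = ?V and f = f, OF G ground Vh] show ?thesis
      by (simp add: K_def mult_ac)
  qed
  have "max_dist w N k (K / (2 * \<alpha>) * X) \<le> 1 / 4"
  proof (subst max_dist_le_iff [OF configs_nonempty [OF k(2)]], intro ballI)
    fix \<xi> E assume "\<xi> \<in> configs N k" and E: "E \<in> Pow (configs N k)"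
    then obtain A where A: "A \<in> occ_sets N k" and \<xi>: "\<xi> = config N A"
      using bij_betw_imp_surj_on [OF bij_config, of N k] by (metis imageE)
    let ?d = "law_at w N (K / (2 * \<alpha>) * X) \<xi> E - equilibrium w N k E"
    have "?d\<^sup>2 \<le> (\<Sum>B\<in>occ_sets N k. weight ?V B) / weight ?V A * exp (- (2 * \<alpha> / K * (K / (2 * \<alpha>) * X)))"
      unfolding \<xi> using w w01 K \<alpha> A E X poincare
      by (intro law_at_convergence [where G = G]) auto
    also have "2 * \<alpha> / K * (K / (2 * \<alpha>) * X) = X" using K \<alpha> by simp
    also have "(\<Sum>B\<in>occ_sets N k. weight ?V B) / weight ?V A \<le>
        exp (real k * ln (real N) + 2 * real k * (real N * L))"
      using abs_potential_le [OF w \<alpha>] by (intro partition_ratio_le A k(2) N) (simp add: L_def)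
    also have "exp (real k * ln (real N) + 2 * real k * (real N * L)) * exp (- X) = (1 / 4)\<^sup>2"
      by (simp add: X_def exp_minus power2_eq_square flip: exp_add)
    finally have "\<bar>?d\<bar>\<^sup>2 \<le> (1 / 4)\<^sup>2" by simp
    then show "\<bar>?d\<bar> \<le> 1 / 4" by (rule power2_le_imp_le) simp
  qed
  then have "t_mix w N k \<le> ereal (K / (2 * \<alpha>) * X)"
    unfolding t_mix_def using K X \<alpha> by (intro Inf_lower) auto
  then show ?thesis by (simp add: K_def X_def)
qed

section \<open>Measurability of the mixing time\<close>

text \<open>Expresses an infimum over real times by countably many conditions at rational times. The
  vanishing slack in time and in distance makes up for the restriction to rationals.\<close>

lemma t_mix_le_iff:
  assumes k: "k \<le> N"
  shows "t_mix w N k \<le> ereal T \<longleftrightarrow> (\<forall>n. \<exists>r::rat. 0 \<le> real_of_rat r \<and> real_of_rat r < T + 1 / real (Suc n) \<and>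
    (\<forall>\<xi>\<in>configs N k. \<forall>A\<in>Pow (configs N k).
       \<bar>law_at w N (real_of_rat r) \<xi> A - equilibrium w N k A\<bar> \<le> 1 / 4 + 1 / real (Suc n)))"
    (is "?l \<longleftrightarrow> (\<forall>n. \<exists>r. ?P n r)")
proof
  let ?S = "configs N k"
  let ?d = "\<lambda>t \<xi> A. \<bar>law_at w N t \<xi> A - equilibrium w N k A\<bar>"
  have cont: "isCont (\<lambda>t. ?d t \<xi> A) t" if "\<xi> \<in> ?S" for \<xi> A t
    using continuous_law_at [OF that, of w A]
    by (intro continuous_intros) (simp add: continuous_on_eq_continuous_at)
  note md = max_dist_le_iff [OF configs_nonempty [OF k]]
  {
    assume ?l
    show "\<forall>n. \<exists>r. ?P n r"
    proof
      fix n
      let ?e = "1 / real (Suc n)"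
      have "t_mix w N k < ereal (T + ?e)" by (rule le_less_trans [OF \<open>?l\<close>]) simp
      then obtain t where t: "0 \<le> t" "max_dist w N k t \<le> 1 / 4" "t < T + ?e"
        unfolding t_mix_def Inf_less_iff by auto
      have "\<forall>\<^sub>F s in at_right t. \<forall>\<xi>\<in>?S. \<forall>A\<in>Pow ?S. ?d s \<xi> A < 1 / 4 + ?e"
      proof (intro eventually_ball_finite ballI)
        fix \<xi> A assume \<xi>: "\<xi> \<in> ?S" and A: "A \<in> Pow ?S"
        have "?d t \<xi> A \<le> 1 / 4" using t(2) [unfolded md] \<xi> A by blast
        also have "\<dots> < 1 / 4 + ?e" by simp
        finally have "?d t \<xi> A < 1 / 4 + ?e" .
        moreover have "((\<lambda>s. ?d s \<xi> A) \<longlongrightarrow> ?d t \<xi> A) (at_right t)"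
          using cont [OF \<xi>, where A = A and t = t] unfolding isCont_def by (rule tendsto_within_subset) simp
        ultimately show "\<forall>\<^sub>F s in at_right t. ?d s \<xi> A < 1 / 4 + ?e"
          by (simp add: order_tendstoD(2))
      qed auto
      then obtain b where b: "t < b" "\<And>s. t < s \<Longrightarrow> s < b \<Longrightarrow> \<forall>\<xi>\<in>?S. \<forall>A\<in>Pow ?S. ?d s \<xi> A < 1 / 4 + ?e"
        unfolding eventually_at_right_field by blast
      \<comment> \<open>The rational time is taken to the right of \<open>t\<close>, which keeps it
        nonnegative.\<close>
      obtain r where r: "t < real_of_rat r" "real_of_rat r < min b (T + ?e)"
        using of_rat_dense [of t "min b (T + ?e)"] b(1) t(3) by auto
      then have "\<forall>\<xi>\<in>?S. \<forall>A\<in>Pow ?S. ?d (real_of_rat r) \<xi> A < 1 / 4 + ?e" using b(2) by simp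
      moreover have "0 \<le> real_of_rat r" using r(1) t(1) by linarith
      ultimately show "\<exists>r. ?P n r" using r(2) by (intro exI [of _ r]) (auto intro: less_imp_le)
    qed
  next
    assume "\<forall>n. \<exists>r. ?P n r"
    then obtain r where r: "\<And>n. ?P n (r n)" by metis
    let ?t = "\<lambda>n. real_of_rat (r n)"
    have "?t n \<in> {0..T + 1}" for n
    proof -
      have "1 / real (Suc n) \<le> 1" by simp
      then have "?t n \<le> T + 1" using r [of n] by linarith
      then show ?thesis using r [of n] by simp
    qed
    \<comment> \<open>A limit point of the approximate times; by continuity the distance there is at
      most \<open>1 / 4\<close>.\<close>
    then obtain l \<sigma> where \<sigma>: "strict_mono \<sigma>" and l: "(?t \<circ> \<sigma>) \<longlonglongrightarrow> l"
      using compact_Icc [of 0 "T + 1"] unfolding compact_def by metis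
    have e: "(\<lambda>n. 1 / real (Suc (\<sigma> n))) \<longlonglongrightarrow> 0"
      using LIMSEQ_subseq_LIMSEQ [OF LIMSEQ_Suc [OF lim_1_over_n] \<sigma>] by (simp add: o_def)
    have "0 \<le> l" using r by (intro LIMSEQ_le_const [OF l]) auto
    have "l \<le> T + 0"
      using r by (intro LIMSEQ_le [OF l tendsto_add [OF tendsto_const e]]) (auto intro: less_imp_le)
    have "max_dist w N k l \<le> 1 / 4"
      unfolding md
    proof (intro ballI)
      fix \<xi> A assume \<xi>: "\<xi> \<in> ?S" and A: "A \<in> Pow ?S"
      have "(\<lambda>n. ?d (?t (\<sigma> n)) \<xi> A) \<longlonglongrightarrow> ?d l \<xi> A"
        using isCont_tendsto_compose [OF cont [OF \<xi>] l] by (simp add: o_def)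
      then have "?d l \<xi> A \<le> 1 / 4 + 0"
        using r \<xi> A by (intro LIMSEQ_le [OF _ tendsto_add [OF tendsto_const e]]) auto
      then show "?d l \<xi> A \<le> 1 / 4" by simp
    qed
    then have "t_mix w N k \<le> ereal l" unfolding t_mix_def using \<open>0 \<le> l\<close> by (intro Inf_lower) auto
    also have "\<dots> \<le> ereal T" using \<open>l \<le> T + 0\<close> by simp
    finally show ?l .
  }
qed

lemma measurable_generator:
  assumes [measurable]: "\<And>x. \<omega> x \<in> borel_measurable M" "\<And>\<xi>. (\<lambda>a. f a \<xi>) \<in> borel_measurable M"
  shows "(\<lambda>a. generator (\<lambda>x. \<omega> x a) N (f a) \<xi>) \<in> borel_measurable M"
  unfolding generator_def jump_rate_def by measurable

lemma measurable_law_at: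
  assumes "\<And>x. \<omega> x \<in> borel_measurable M"
  shows "(\<lambda>a. law_at (\<lambda>x. \<omega> x a) N t \<xi> A) \<in> borel_measurable M"
proof -
  have [measurable]: "(\<lambda>a. (generator (\<lambda>x. \<omega> x a) N ^^ n) (indicator A) \<xi>) \<in> borel_measurable M" for n \<xi>
  proof (induction n arbitrary: \<xi>)
    case (Suc n)
    then show ?case by (simp add: measurable_generator assms)
  qed simp
  show ?thesis unfolding law_at_def semigroup_def by measurable
qed

lemma measurable_equilibrium:
  assumes [measurable]: "\<And>x. \<omega> x \<in> borel_measurable M"
  shows "(\<lambda>a. equilibrium (\<lambda>x. \<omega> x a) N k A) \<in> borel_measurable M"
  unfolding equilibrium_def config_potential_def potential_def by measurable

lemma sets_t_mix_le:
  assumes "\<And>x. \<omega> x \<in> borel_measurable M" "k \<le> N"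
  shows "{a \<in> space M. t_mix (\<lambda>x. \<omega> x a) N k \<le> ereal T} \<in> sets M"
proof -
  let ?e = "\<lambda>t \<xi> A a. \<bar>law_at (\<lambda>x. \<omega> x a) N t \<xi> A - equilibrium (\<lambda>x. \<omega> x a) N k A\<bar>"
  have *: "{a \<in> space M. ?e t \<xi> A a \<le> c} \<in> sets M" for t \<xi> A c
  proof -
    have [measurable]: "?e t \<xi> A \<in> borel_measurable M"
      by (intro borel_measurable_abs borel_measurable_diff measurable_law_at measurable_equilibrium assms)
    show ?thesis by measurable
  qed
  have **: "{a \<in> space M. \<forall>\<xi>\<in>configs N k. \<forall>A\<in>Pow (configs N k). ?e t \<xi> A a \<le> c} \<in> sets M" for t c
    using * by (intro sets.sets_Collect_finite_All) auto
  show ?thesis unfolding t_mix_le_iff [OF assms(2)]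
    by (intro sets.sets_Collect_countable_All sets.sets_Collect_countable_Ex sets.sets_Collect_conj
      sets.sets_Collect_const **)
qed

section \<open>Exponential moments of the environment\<close>

context prob_space
begin

definition mgf :: "('a \<Rightarrow> real) \<Rightarrow> real \<Rightarrow> real" where
  "mgf X u = expectation (\<lambda>a. exp (u * X a))"

context
  fixes X :: "'a \<Rightarrow> real" and L :: real
  assumes X [measurable]: "X \<in> borel_measurable M" and bound: "AE a in M. \<bar>X a\<bar> \<le> L"
begin

lemma integrable_bounded: "integrable M X"
  by (rule integrable_const_bound [where B = L]) (use bound in simp_all)

lemma integrable_exp_bounded: "integrable M (\<lambda>a. exp (u * X a))"
proof (rule integrable_const_bound [where B = "exp (\<bar>u\<bar> * L)"])
  show "AE a in M. norm (exp (u * X a)) \<le> exp (\<bar>u\<bar> * L)"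
    using bound
  proof eventually_elim
    case (elim a)
    have "u * X a \<le> \<bar>u\<bar> * \<bar>X a\<bar>" by (metis abs_ge_self abs_mult)
    also have "\<dots> \<le> \<bar>u\<bar> * L" using elim by (intro mult_left_mono) auto
    finally show ?case by simp
  qed
qed measurable

lemma mgf_0 [simp]: "mgf X 0 = 1"
  by (simp add: mgf_def prob_space)

lemma mgf_ge: "mgf X u \<ge> exp (- (\<bar>u\<bar> * L))"
proof -
  have "expectation (\<lambda>_. exp (- (\<bar>u\<bar> * L))) \<le> mgf X u"
    unfolding mgf_def
  proof (rule integral_mono_AE [OF _ integrable_exp_bounded])
    show "AE a in M. exp (- (\<bar>u\<bar> * L)) \<le> exp (u * X a)"
      using bound
    proof eventually_elim
      case (elim a)
      have "- (u * X a) \<le> \<bar>u\<bar> * \<bar>X a\<bar>" by (metis abs_ge_minus_self abs_mult)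
      also have "\<dots> \<le> \<bar>u\<bar> * L" using elim by (intro mult_left_mono) auto
      finally show ?case by simp
    qed
  qed simp
  then show ?thesis by (simp add: prob_space)
qed

lemma convex_mgf: "convex_on UNIV (mgf X)"
proof (rule convex_onI)
  fix t u v :: real assume t: "0 < t" "t < 1"
  have "mgf X ((1 - t) *\<^sub>R u + t *\<^sub>R v) \<le> expectation (\<lambda>a. (1 - t) * exp (u * X a) + t * exp (v * X a))"
    unfolding mgf_def
  proof (rule integral_mono)
    fix a
    show "exp (((1 - t) *\<^sub>R u + t *\<^sub>R v) * X a) \<le> (1 - t) * exp (u * X a) + t * exp (v * X a)"
      using convex_onD [OF exp_convex, of t "u * X a" "v * X a"] t by (simp add: algebra_simps)
  qed (use integrable_exp_bounded in auto)
  also have "\<dots> = (1 - t) * mgf X u + t * mgf X v"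
    unfolding mgf_def by (simp add: integrable_exp_bounded)
  finally show "mgf X ((1 - t) *\<^sub>R u + t *\<^sub>R v) \<le> (1 - t) * mgf X u + t * mgf X v" .
qed simp

text \<open>A second order bound replaces differentiation under the integral: for
  \<open>y \<le> 1 / 2\<close> one has \<open>exp y \<le> 1 + y + 2 * y\<^sup>2\<close>, and for
  small positive \<open>u\<close> the negative drift outweighs the quadratic term.\<close>

lemma mgf_less_1:
  assumes drift: "expectation X < 0"
  shows "\<exists>u. mgf X u < 1"
proof -
  define m where "m = expectation X"
  have m: "m < 0" using drift by (simp add: m_def)
  define K where "K = \<bar>L\<bar> + 1"
  have K: "1 \<le> K" "AE a in M. \<bar>X a\<bar> \<le> K" using bound by (auto simp: K_def elim: eventually_mono)
  \<comment> \<open>The first bound keeps \<open>u * X\<close> within \<open>1 / 2\<close>, the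
    second makes the quadratic term at most half of the drift term.\<close>
  define u where "u = min (1 / (2 * K)) (- m / (4 * K\<^sup>2))"
  have u: "0 < u" "u * K \<le> 1 / 2" "2 * u * K\<^sup>2 \<le> - m / 2"
    using m K(1) by (auto simp: u_def min_def field_simps power2_eq_square)
  have "mgf X u \<le> expectation (\<lambda>a. 1 + u * X a + 2 * (u * K)\<^sup>2)"
    unfolding mgf_def
  proof (rule integral_mono_AE [OF integrable_exp_bounded])
    show "AE a in M. exp (u * X a) \<le> 1 + u * X a + 2 * (u * K)\<^sup>2"
      using K(2)
    proof eventually_elim
      case (elim a)
      define y where "y = u * X a"
      have y: "\<bar>y\<bar> \<le> u * K" using elim u by (simp add: y_def abs_mult)
      then have y2: "y \<le> 1 / 2" using u by linarith
      have "1 - y \<le> exp (- y)" using exp_ge_add_one_self [of "- y"] by simp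
      then have "exp y * (1 - y) \<le> exp y * exp (- y)" by (intro mult_left_mono) auto
      then have "exp y * (1 - y) \<le> 1" by (simp flip: exp_add)
      also have "1 \<le> (1 + y + 2 * y\<^sup>2) * (1 - y)"
      proof -
        have "(1 + y + 2 * y\<^sup>2) * (1 - y) = 1 + y\<^sup>2 * (1 - 2 * y)"
          by (simp add: algebra_simps power2_eq_square)
        moreover have "0 \<le> y\<^sup>2 * (1 - 2 * y)" using y2 by (intro mult_nonneg_nonneg) auto
        ultimately show ?thesis by simp
      qed
      finally have "exp y \<le> 1 + y + 2 * y\<^sup>2" using y2 by (simp add: mult_le_cancel_right)
      moreover have "y\<^sup>2 \<le> (u * K)\<^sup>2" using power_mono [OF y, of 2] by simp
      ultimately show ?case by (simp add: y_def)
    qed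
  qed (use integrable_bounded in auto)
  also have "\<dots> = 1 + u * m + 2 * (u * K)\<^sup>2"
    using integrable_bounded by (simp add: m_def prob_space)
  also have "2 * (u * K)\<^sup>2 = u * (2 * u * K\<^sup>2)" by (simp add: power2_eq_square)
  also have "u * (2 * u * K\<^sup>2) \<le> u * (- m / 2)" using u by (intro mult_left_mono) auto
  also have "1 + u * m + u * (- m / 2) = 1 + u * m / 2" by (simp add: field_simps)
  also have "\<dots> < 1" using u m by (simp add: mult_pos_neg)
  finally show ?thesis by auto
qed

text \<open>Outside the interval from 0 to \<open>s\<close> the function is at least 1, on the left
  by \<open>1 + x \<le> exp x\<close> and on the right by convexity, so a minimum over the compact
  interval is global. The second claim concerns every minimiser, because the one of interest is
  given by a choice operator.\<close>

lemma mgf_minimum: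
  assumes drift: "expectation X < 0" and s: "0 < s" "1 \<le> mgf X s"
  shows "\<exists>u. \<forall>v. mgf X u \<le> mgf X v"
    and "(\<And>v. mgf X u \<le> mgf X v) \<Longrightarrow> 0 < u \<and> mgf X u < 1"
proof -
  have neg: "1 \<le> mgf X u" if "u \<le> 0" for u
  proof -
    have "1 \<le> 1 + u * expectation X" using that drift by (simp add: mult_nonpos_nonpos)
    also have "\<dots> = expectation (\<lambda>a. 1 + u * X a)" using integrable_bounded by (simp add: prob_space)
    also have "\<dots> \<le> mgf X u" unfolding mgf_def
      using integrable_bounded by (intro integral_mono integrable_exp_bounded exp_ge_add_one_self) auto
    finally show ?thesis .
  qed
  have big: "1 \<le> mgf X u" if "s \<le> u" for u
  proof -
    \<comment> \<open>\<open>s\<close> is a convex combination of 0 and \<open>u\<close>, and the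
      function is 1 at 0 and at least 1 at \<open>s\<close>.\<close>
    have "mgf X ((1 - s / u) *\<^sub>R 0 + (s / u) *\<^sub>R u) \<le> (1 - s / u) * mgf X 0 + s / u * mgf X u"
      using that s by (intro convex_onD [OF convex_mgf]) auto
    then have "1 \<le> (1 - s / u) + s / u * mgf X u" using s that by simp
    then have "s / u * 1 \<le> s / u * mgf X u" by simp
    moreover have "0 < s / u" using s that by simp
    ultimately show ?thesis by (simp only: mult_le_cancel_left_pos)
  qed
  have "continuous_on {0..s} (mgf X)"
    using convex_on_continuous [OF open_UNIV convex_mgf] continuous_on_subset by blast
  then obtain u where u: "u \<in> {0..s}" "\<And>v. v \<in> {0..s} \<Longrightarrow> mgf X u \<le> mgf X v"
    using continuous_attains_inf [of "{0..s}" "mgf X"] s by auto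
  have "mgf X u \<le> 1" using u(2) [of 0] s by simp
  have "mgf X u \<le> mgf X v" for v
    using u(2) [of v] neg [of v] big [of v] \<open>mgf X u \<le> 1\<close> by (cases "v \<le> 0"; cases "s \<le> v") auto
  then show "\<exists>u. \<forall>v. mgf X u \<le> mgf X v" by blast
  show "0 < u \<and> mgf X u < 1" if min: "\<And>v. mgf X u \<le> mgf X v" for u
  proof -
    obtain v where "mgf X v < 1" using mgf_less_1 [OF drift] by blast
    then have "mgf X u < 1" using min [of v] by simp
    then show ?thesis using neg [of u] by linarith
  qed
qed

end

end

section \<open>The random environment and its tail bounds\<close>

locale random_environment = prob_space M for M :: "'a measure" +
  fixes \<omega> :: "int \<Rightarrow> 'a \<Rightarrow> real" and \<alpha> :: real
  assumes iid: "iid_environment \<omega>"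
    and \<alpha>: "0 < \<alpha>" "\<alpha> < 1 / 2"
    and bounded: "prob {a \<in> space M. \<omega> 1 a \<in> {\<alpha>..1 - \<alpha>}} = 1"
    and drift: "expectation (\<lambda>a. ln (rho (\<omega> 1 a))) < 0"
    and lambda_finite: "lambda_env \<omega> < \<infinity>"
begin

definition L :: real where "L = ln ((1 - \<alpha>) / \<alpha>)"

definition umin :: real where "umin = u0_env \<omega>"

abbreviation log_rho :: "int \<Rightarrow> 'a \<Rightarrow> real" where
  "log_rho x \<equiv> \<lambda>a. ln (rho (\<omega> x a))"

lemma L_pos: "0 < L"
  unfolding L_def using \<alpha> by (simp add: field_simps)

lemma measurable_omega [measurable]: "\<omega> x \<in> borel_measurable M"
  using iid by (auto simp: iid_environment_def indep_vars_def)

lemma measurable_rho [measurable]: "rho \<in> borel_measurable borel"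
  unfolding rho_def by measurable

lemma same_distr: "distr M borel (\<omega> x) = distr M borel (\<omega> 1)"
  using iid by (auto simp: iid_environment_def)

lemma AE_omega: "AE a in M. \<omega> x a \<in> {\<alpha>..1 - \<alpha>}"
proof -
  have "AE a in M. \<omega> 1 a \<in> {\<alpha>..1 - \<alpha>}" using AE_prob_1 [OF bounded] by simp
  then have "AE y in distr M borel (\<omega> 1). y \<in> {\<alpha>..1 - \<alpha>}" by (subst AE_distr_iff) auto
  then have "AE y in distr M borel (\<omega> x). y \<in> {\<alpha>..1 - \<alpha>}" by (simp only: same_distr [of x])
  then show ?thesis by (subst (asm) AE_distr_iff) auto
qed

lemma AE_log_rho: "AE a in M. \<bar>log_rho x a\<bar> \<le> L"
  using AE_omega [of x]
proof eventually_elim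
  case (elim a)
  then have "log_rho x a = ln (1 - \<omega> x a) - ln (\<omega> x a)" using \<alpha> by (simp add: rho_def ln_div)
  then show ?case unfolding L_def using abs_ln_ratio_le [of \<alpha> "1 - \<omega> x a" "\<omega> x a"] elim \<alpha> by simp
qed

lemma measurable_log_rho [measurable]: "log_rho x \<in> borel_measurable M"
  by measurable

lemma mgf_log_rho: "mgf (log_rho x) u = mgf (log_rho 1) u"
proof -
  have "mgf (log_rho x) u = integral\<^sup>L (distr M borel (\<omega> x)) (\<lambda>y. exp (u * ln (rho y)))" for x
    unfolding mgf_def by (subst integral_distr) auto
  then show ?thesis by (simp only: same_distr [of x])
qed

lemma rho_moment_eq: "rho_moment \<omega> u = mgf (log_rho 1) u"
  unfolding rho_moment_def mgf_def
proof (rule integral_cong_AE)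
  show "AE a in M. rho (\<omega> 1 a) powr u = exp (u * log_rho 1 a)"
    using AE_omega [of 1]
  proof eventually_elim
    case (elim a)
    \<comment> \<open>At base 0 the value of \<open>powr\<close> is 0 by convention and differs from
      the exponential.\<close>
    then have "rho (\<omega> 1 a) \<noteq> 0" using \<alpha> by (auto simp: rho_def)
    then show ?case by (simp add: powr_def)
  qed
qed measurable

lemma mgf_minimum_log_rho:
  shows "\<exists>u. \<forall>v. mgf (log_rho 1) u \<le> mgf (log_rho 1) v"
    and "(\<And>v. mgf (log_rho 1) u \<le> mgf (log_rho 1) v) \<Longrightarrow> 0 < u \<and> mgf (log_rho 1) u < 1"
proof -
  \<comment> \<open>The infimum of the empty set is infinite, so finiteness provides some
    \<open>s\<close> whose moment is at least 1.\<close>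
  have "{ereal s | s. s > 0 \<and> rho_moment \<omega> s \<ge> 1} \<noteq> {}"
    using lambda_finite unfolding lambda_env_def by (metis Inf_empty less_irrefl top_ereal_def)
  then obtain s where "0 < s" "1 \<le> mgf (log_rho 1) s" by (auto simp: rho_moment_eq)
  note * = mgf_minimum [OF measurable_log_rho AE_log_rho drift this]
  show "\<exists>u. \<forall>v. mgf (log_rho 1) u \<le> mgf (log_rho 1) v" by (rule *(1))
  show "(\<And>v. mgf (log_rho 1) u \<le> mgf (log_rho 1) v) \<Longrightarrow> 0 < u \<and> mgf (log_rho 1) u < 1" by (rule *(2))
qed

lemma mgf_log_rho_pos: "0 < mgf (log_rho 1) u"
  using mgf_ge [OF measurable_log_rho AE_log_rho, of u 1] by (rule less_le_trans [OF exp_gt_zero])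

text \<open>As \<open>ln\<close> is increasing on the positive moments, \<open>F_env\<close> has the
  same minimisers as the moment. The existence of one makes the choice in \<open>ARG_MIN\<close> an
  actual minimiser.\<close>

lemma u0_pos: "0 < umin" and mgf_u0: "mgf (log_rho 1) umin < 1"
proof -
  have F: "F_env \<omega> u \<le> F_env \<omega> v \<longleftrightarrow> mgf (log_rho 1) u \<le> mgf (log_rho 1) v" for u v
    using mgf_log_rho_pos by (simp add: F_env_def rho_moment_eq)
  obtain u where "is_arg_min (F_env \<omega>) (\<lambda>_. True) u"
    using mgf_minimum_log_rho(1) by (auto simp: is_arg_min_linorder F)
  then have "is_arg_min (F_env \<omega>) (\<lambda>_. True) umin"
    unfolding umin_def u0_env_def arg_min_def by (rule someI)
  then have "mgf (log_rho 1) umin \<le> mgf (log_rho 1) v" for v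
    by (simp add: is_arg_min_linorder F)
  from mgf_minimum_log_rho(2) [OF this] show "0 < umin" "mgf (log_rho 1) umin < 1" by auto
qed

definition \<phi> :: real where "\<phi> = mgf (log_rho 1) umin"

lemma \<phi>: "0 < \<phi>" "\<phi> < 1" "exp (- (umin * L)) \<le> \<phi>"
  using mgf_log_rho_pos mgf_u0 mgf_ge [OF measurable_log_rho AE_log_rho, of umin 1] u0_pos by (auto simp: \<phi>_def)

lemma F_u0: "F_env \<omega> umin = ln \<phi>"
  by (simp add: F_env_def rho_moment_eq \<phi>_def)

text \<open>Chernoff's bound at the exponent \<open>umin\<close>, where the moment of a single
  factor is smallest; independence turns the moment of the sum into a power of
  \<open>\<phi>\<close>.\<close>

lemma log_rho_sum_tail:
  "prob {a \<in> space M. h < (\<Sum>z\<in>I. log_rho z a)} \<le> exp (- (umin * h)) * \<phi> ^ card I" if I: "finite I"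
proof -
  have indep: "indep_vars (\<lambda>_. borel) (\<lambda>z a. exp (umin * log_rho z a)) I"
  proof (rule indep_vars_compose2 [where X = \<omega> and Y = "\<lambda>_ y. exp (umin * ln (rho y))"])
    show "indep_vars (\<lambda>_. borel) \<omega> I"
      by (rule indep_vars_subset [of _ _ UNIV]) (use iid in \<open>auto simp: iid_environment_def\<close>)
  qed auto
  have int: "integrable M (\<lambda>a. exp (umin * log_rho z a))" for z
    by (rule integrable_exp_bounded [OF measurable_log_rho AE_log_rho])
  have prod: "exp (umin * (\<Sum>z\<in>I. log_rho z a)) = (\<Prod>z\<in>I. exp (umin * log_rho z a))" for a
    using I by (simp add: sum_distrib_left exp_sum)
  have "prob {a \<in> space M. h < (\<Sum>z\<in>I. log_rho z a)} \<le>
      prob {a \<in> space M. exp (umin * h) \<le> exp (umin * (\<Sum>z\<in>I. log_rho z a))}"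
    using u0_pos by (intro finite_measure_mono) auto
  also have "\<dots> \<le> expectation (\<lambda>a. exp (umin * (\<Sum>z\<in>I. log_rho z a))) / exp (umin * h)"
  proof (rule integral_Markov_inequality_measure [where A = "space M"])
    show "integrable M (\<lambda>a. exp (umin * (\<Sum>z\<in>I. log_rho z a)))"
      unfolding prod by (intro indep_vars_integrable I indep int)
  qed auto
  also have "expectation (\<lambda>a. exp (umin * (\<Sum>z\<in>I. log_rho z a))) = (\<Prod>z\<in>I. mgf (log_rho z) umin)"
    unfolding prod mgf_def by (intro indep_vars_lebesgue_integral I indep int)
  also have "\<dots> = (\<Prod>z\<in>I. \<phi>)" unfolding \<phi>_def by (intro prod.cong refl mgf_log_rho)
  also have "\<dots> = \<phi> ^ card I" by simp
  finally show ?thesis by (simp add: exp_minus field_simps)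
qed

section \<open>The probability of a good environment\<close>

text \<open>The bounds on \<open>\<omega>\<close>, which hold almost surely, are part of the event,
  so that the deterministic mixing time bound applies at each of its points.\<close>

definition good :: "nat \<Rightarrow> real \<Rightarrow> real \<Rightarrow> real \<Rightarrow> 'a set" where
  "good N h q s = {a \<in> space M. (\<forall>z\<in>{1..int N}. \<omega> z a \<in> {\<alpha>..1 - \<alpha>}) \<and>
     (\<forall>x\<in>{1..int N}. \<forall>y\<in>{x..int N}. (\<Sum>z = x + 1..y. log_rho z a) \<le> h \<and>
        (q \<le> real_of_int (y - x) \<longrightarrow> (\<Sum>z = x + 1..y. log_rho z a) \<le> - s))}"

lemma sets_good: "good N h q s \<in> sets M"
proof -
  have [measurable]: "{a \<in> space M. (\<Sum>z = x + 1..y. log_rho z a) \<le> h} \<in> sets M" for x y h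
    by measurable
  show ?thesis unfolding good_def
    by (intro sets.sets_Collect_conj sets.sets_Collect_finite_All sets.sets_Collect_imp
      sets.sets_Collect_const) measurable
qed

text \<open>A union bound over pairs of sites. For the increments the tail decays geometrically in
  the distance, so summing over \<open>y\<close> leaves a single factor \<open>N\<close>; for the
  drops the pairs are counted by \<open>N ^ 2\<close>.\<close>

lemma prob_good:
  "1 - prob (good N h q s) \<le> real N * exp (- (umin * h)) / (1 - \<phi>) + real N ^ 2 * (exp (umin * s) * \<phi> powr q)"
proof -
  let ?S = "\<lambda>x y a. \<Sum>z = x + 1..y. log_rho z a"
  define A B where "A x y = {a \<in> space M. h < ?S x y a}" and
    "B x y = {a \<in> space M. q \<le> real_of_int (y - x) \<and> - s < ?S x y a}" for x y
  define P where "P = (SIGMA x:{1..int N}. {x..int N})"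
  have finP: "finite P" by (simp add: P_def)
  have [measurable]: "A x y \<in> sets M" "B x y \<in> sets M" for x y
    unfolding A_def B_def by measurable
  have UN: "(\<Union>(x, y)\<in>P. A x y) \<in> sets M" "(\<Union>(x, y)\<in>P. B x y) \<in> sets M"
    by (intro sets.finite_UN finP; auto)+
  have "AE a in M. \<forall>z\<in>{1..int N}. \<omega> z a \<in> {\<alpha>..1 - \<alpha>}"
    using AE_omega by (intro AE_finite_allI) auto
  then have "AE a in M. a \<in> space M - good N h q s \<longrightarrow> a \<in> (\<Union>(x, y)\<in>P. A x y) \<union> (\<Union>(x, y)\<in>P. B x y)"
  proof eventually_elim
    case (elim a)
    then show ?case by (force simp: good_def A_def B_def P_def not_le)
  qed
  then have "prob (space M - good N h q s) \<le> prob ((\<Union>(x, y)\<in>P. A x y) \<union> (\<Union>(x, y)\<in>P. B x y))"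
    using UN by (intro finite_measure_mono_AE) auto
  also have "\<dots> \<le> prob (\<Union>(x, y)\<in>P. A x y) + prob (\<Union>(x, y)\<in>P. B x y)"
    using UN by (rule measure_Un_le)
  also have "\<dots> \<le> (\<Sum>(x, y)\<in>P. prob (A x y)) + (\<Sum>(x, y)\<in>P. prob (B x y))"
    unfolding case_prod_unfold using finP by (intro add_mono finite_measure_subadditive_finite) auto
  also have "(\<Sum>(x, y)\<in>P. prob (A x y)) \<le> (\<Sum>(x, y)\<in>P. exp (- (umin * h)) * \<phi> ^ nat (y - x))"
  proof (intro sum_mono, clarify)
    fix x y assume "(x, y) \<in> P"
    then show "prob (A x y) \<le> exp (- (umin * h)) * \<phi> ^ nat (y - x)"
      unfolding A_def using log_rho_sum_tail [of "{x + 1..y}" h] by (simp add: P_def)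
  qed
  also have "\<dots> = exp (- (umin * h)) * (\<Sum>x\<in>{1..int N}. \<Sum>y\<in>{x..int N}. \<phi> ^ nat (y - x))"
    unfolding P_def by (subst sum.Sigma [symmetric]) (auto simp: sum_distrib_left)
  also have "\<dots> \<le> exp (- (umin * h)) * (\<Sum>x\<in>{1..int N}. 1 / (1 - \<phi>))"
  proof (intro mult_left_mono sum_mono)
    fix x :: int
    have "(\<Sum>y\<in>{x..int N}. \<phi> ^ nat (y - x)) = (\<Sum>i\<in>(\<lambda>y. nat (y - x)) ` {x..int N}. \<phi> ^ i)"
      by (subst sum.reindex) (auto simp: inj_on_def)
    also have "\<dots> \<le> (\<Sum>i. \<phi> ^ i)"
      using \<phi> by (intro sum_le_suminf summable_geometric) auto
    also have "\<dots> = 1 / (1 - \<phi>)" using \<phi> by (intro suminf_geometric) auto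
    finally show "(\<Sum>y\<in>{x..int N}. \<phi> ^ nat (y - x)) \<le> 1 / (1 - \<phi>)" .
  qed simp
  also have "(\<Sum>(x, y)\<in>P. prob (B x y)) \<le> (\<Sum>(x, y)\<in>P. exp (umin * s) * \<phi> powr q)"
  proof (intro sum_mono, clarify)
    fix x y assume xy: "(x, y) \<in> P"
    show "prob (B x y) \<le> exp (umin * s) * \<phi> powr q"
    proof (cases "q \<le> real_of_int (y - x)")
      case True
      have "prob (B x y) \<le> exp (umin * s) * \<phi> ^ nat (y - x)"
        unfolding B_def using log_rho_sum_tail [of "{x + 1..y}" "- s"] True by simp
      also have "\<phi> ^ nat (y - x) = \<phi> powr real_of_int (y - x)"
        using \<phi> xy by (simp add: P_def flip: powr_realpow)
      also have "\<dots> \<le> \<phi> powr q" using True \<phi> by (intro powr_mono') auto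
      finally show ?thesis by simp
    qed (simp add: B_def)
  qed
  also have "\<dots> = real (card P) * (exp (umin * s) * \<phi> powr q)" by simp
  also have "\<dots> \<le> real N ^ 2 * (exp (umin * s) * \<phi> powr q)"
  proof (intro mult_right_mono)
    have "card P \<le> card ({1..int N} \<times> {1..int N})" by (intro card_mono) (auto simp: P_def)
    then show "real (card P) \<le> real N ^ 2" by (simp add: card_cartesian_product power2_eq_square flip: of_nat_mult)
  qed simp
  finally have "prob (space M - good N h q s) \<le>
    exp (- (umin * h)) * (\<Sum>x\<in>{1..int N}. 1 / (1 - \<phi>)) + real N ^ 2 * (exp (umin * s) * \<phi> powr q)" by simp
  then show ?thesis by (simp add: prob_compl [OF sets_good] mult_ac)
qed

end

section \<open>Typical environments\<close>

context random_environment
begin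

definition c0 :: real where "c0 = (3 * umin + 2) / \<bar>F_env \<omega> umin\<bar>"

lemma c_pos: "0 < c0"
  unfolding c0_def F_u0 using u0_pos \<phi> by (intro divide_pos_pos) auto

lemma c_ln: "c0 * ln \<phi> = - (3 * umin + 2)"
proof -
  have "ln \<phi> < 0" using \<phi> by simp
  then show ?thesis by (simp add: c0_def F_u0 field_simps)
qed

text \<open>A consequence of \<open>\<bar>F u\<^sub>0\<bar> \<le> u\<^sub>0 * L\<close>: the part
  \<open>2 * L\<close> of the exponent pays for six powers of \<open>N\<close> and for the power
  \<open>4 / umin\<close> that comes from \<open>exp (3 * h)\<close>.\<close>

lemma c_L_ge: "6 + 4 / umin \<le> c0 * (2 * L)"
proof -
  have "- (umin * L) \<le> ln \<phi>" using \<phi> by (subst ln_ge_iff) auto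
  then have "c0 * (- (umin * L)) \<le> c0 * ln \<phi>" using c_pos by (intro mult_left_mono) auto
  then have "3 * umin + 2 \<le> c0 * L * umin" by (simp add: c_ln algebra_simps)
  then show ?thesis using u0_pos by (simp add: field_simps)
qed

text \<open>With this \<open>h\<close>, \<open>3 * h\<close> is \<open>4 / umin * ln N\<close>,
  while the increments fail with probability of order \<open>N powr (- 1 / 3)\<close>. The choice of
  \<open>s\<close> keeps \<open>N * exp (- s)\<close> bounded, and \<open>q\<close> is long enough
  for \<open>\<phi> powr q\<close> to beat both the number of pairs and
  \<open>exp (umin * s)\<close>.\<close>

definition good_scale :: "nat \<Rightarrow> 'a set" where
  "good_scale N = good N (4 / (3 * umin) * ln (real N)) (c0 * ln (real N)) (2 * ln (real N))"

lemma prob_good_scale: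
  assumes N: "0 < N"
  shows "1 - (real N powr (- 1 / 3) / (1 - \<phi>) + real N powr (- umin)) \<le> prob (good_scale N)"
proof -
  have exp_ln_mult: "exp (r * ln (real N)) = real N powr r" for r
    using N by (simp add: powr_def)
  have "exp (- (umin * (4 / (3 * umin) * ln (real N)))) = exp (- 4 / 3 * ln (real N))"
    using u0_pos by simp
  then have "real N * exp (- (umin * (4 / (3 * umin) * ln (real N)))) = real N powr 1 * real N powr (- 4 / 3)"
    using N by (simp only: exp_ln_mult powr_one_gt_zero_iff) simp
  also have "\<dots> = real N powr (- 1 / 3)" by (simp only: powr_add [symmetric]) simp
  finally have 1: "real N * exp (- (umin * (4 / (3 * umin) * ln (real N)))) = real N powr (- 1 / 3)" .
  have "\<phi> powr (c0 * ln (real N)) = exp ((c0 * ln \<phi>) * ln (real N))"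
    using \<phi> by (simp add: powr_def mult_ac)
  then have "\<phi> powr (c0 * ln (real N)) = real N powr (- (3 * umin + 2))"
    by (simp only: c_ln exp_ln_mult)
  moreover have "exp (umin * (2 * ln (real N))) = real N powr (2 * umin)"
    by (simp add: mult_ac flip: exp_ln_mult)
  moreover have "real N ^ 2 = real N powr 2" using N by simp
  ultimately have "real N ^ 2 * (exp (umin * (2 * ln (real N))) * \<phi> powr (c0 * ln (real N))) =
      real N powr (2 + (2 * umin + - (3 * umin + 2)))"
    by (simp only: powr_add)
  then have 2: "real N ^ 2 * (exp (umin * (2 * ln (real N))) * \<phi> powr (c0 * ln (real N))) = real N powr (- umin)"
    by simp
  show ?thesis
    using prob_good [of N "4 / (3 * umin) * ln (real N)" "c0 * ln (real N)" "2 * ln (real N)"]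
    unfolding good_scale_def 1 2 by simp
qed

text \<open>Collects the factors independent of \<open>N\<close> and \<open>k\<close>; the leading 2
  is the 4 from the partition function divided by the 2 from the rate
  \<open>2 * \<alpha>\<close>.\<close>

definition mix_const :: real where
  "mix_const = 2 * exp (exp L) * exp (3 * L) * (ln 16 + 1 + 2 * L)"

text \<open>Of the six powers of \<open>N\<close>, four come from the Poincare constant and two
  absorb \<open>k\<close> and \<open>mix_const\<close>. A further factor
  \<open>k * N / \<alpha>\<close> matches the one in the claim.\<close>

lemma t_mix_good_scale:
  assumes a: "a \<in> good_scale N" and k: "1 \<le> k" "real k \<le> real N / 2"
    and N: "1 \<le> c0 * ln (real N)" "mix_const \<le> real N"
  shows "t_mix (\<lambda>x. \<omega> x a) N k \<le>
      ereal (80 * real k * real N * (1 / \<alpha>) * (c0 * ln (real N)) ^ 4 *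
        real N powr (c0 * (2 * ln ((1 - \<alpha>) / \<alpha>) + 4 * ln 4 - 3 * ln 3)))"
proof -
  define n where "n = real N"
  have kN: "k \<le> N" "0 < N" "0 < k" "real k \<le> n" "1 \<le> n" "1 \<le> real k" using k by (auto simp: n_def)
  define h s q where "h = 4 / (3 * umin) * ln n" and "s = 2 * ln n" and "q = c0 * ln n"
  have exp_ln_mult: "exp (r * ln n) = n powr r" for r
    using kN by (simp add: powr_def)
  define bound where "bound = real k * (4 * 4 powr q * exp (real N * exp (L - s))) *
      (real N ^ 4 * exp (3 * (h + L))) / (2 * \<alpha>) * (ln 16 + real k * ln (real N) + 2 * real k * (real N * L))"
  have "t_mix (\<lambda>x. \<omega> x a) N k \<le> ereal bound"
    unfolding bound_def L_def
  proof (rule t_mix_bound)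
    show "\<alpha> \<le> \<omega> z a \<and> \<omega> z a \<le> 1 - \<alpha>" if "z \<in> {1..int N}" for z
      using a that by (auto simp: good_scale_def good_def)
    show "(\<Sum>z = x + 1..y. log_rho z a) \<le> h" if "1 \<le> x" "x \<le> y" "y \<le> int N" for x y
      using a that by (auto simp: good_scale_def good_def h_def n_def)
    show "(\<Sum>z = x + 1..y. log_rho z a) \<le> - s"
      if "1 \<le> x" "x \<le> y" "y \<le> int N" "q \<le> real_of_int (y - x)" for x y
      using a that by (auto simp: good_scale_def good_def s_def q_def n_def)
    show "0 \<le> q" using N by (simp add: q_def n_def)
  qed (use kN \<alpha> in auto)
  also have "ereal bound \<le> ereal (80 * real k * real N * (1 / \<alpha>) * (c0 * ln (real N)) ^ 4 *
        real N powr (c0 * (2 * L + 4 * ln 4 - 3 * ln 3)))"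
  proof -
    have "real N * exp (L - s) = exp L / n"
      using kN by (simp add: s_def exp_diff n_def power2_eq_square exp_double field_simps)
    also have "\<dots> \<le> exp L" using kN by (simp add: field_simps)
    finally have 1: "exp (real N * exp (L - s)) \<le> exp (exp L)" by simp
    have 2: "4 powr q = n powr (c0 * ln 4)"
      by (simp add: q_def powr_def mult_ac kN(2) n_def)
    have "3 * (h + L) = 4 / umin * ln n + 3 * L" using u0_pos by (simp add: h_def field_simps)
    then have 3: "exp (3 * (h + L)) = n powr (4 / umin) * exp (3 * L)"
      by (simp only: exp_add exp_ln_mult)
    have kn: "1 \<le> real k * n" using mult_mono [of 1 "real k" 1 n] kN by simp
    have 4: "ln 16 + real k * ln (real N) + 2 * real k * (real N * L) \<le> real k * n * (ln 16 + 1 + 2 * L)"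
    proof -
      have "0 \<le> ln (16 :: real)" by simp
      from mult_left_mono [OF kn this] have "ln 16 \<le> ln 16 * (real k * n)" by (simp only: mult_1_right)
      moreover have "real k * ln (real N) \<le> real k * n"
        using ln_le_minus_one [of n] kN by (intro mult_left_mono) (auto simp: n_def)
      moreover have "real k * n * (ln 16 + 1 + 2 * L) = ln 16 * (real k * n) + real k * n + 2 * real k * (real N * L)"
        by (simp add: algebra_simps n_def)
      ultimately show ?thesis by linarith
    qed
    have "bound \<le> real k * (4 * n powr (c0 * ln 4) * exp (exp L)) *
      (n ^ 4 * (n powr (4 / umin) * exp (3 * L))) / (2 * \<alpha>) * (real k * n * (ln 16 + 1 + 2 * L))"
      unfolding bound_def 2 3 n_def [symmetric]
      using 1 4 kN \<alpha> L_pos by (intro mult_mono divide_right_mono) (auto simp: n_def intro!: add_nonneg_nonneg)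
    also have "\<dots> = real k * n / \<alpha> * ((real k * mix_const) * n ^ 4 * (n powr (c0 * ln 4) * n powr (4 / umin)))"
      using \<alpha> by (simp add: mix_const_def field_simps)
    also have "\<dots> \<le> real k * n / \<alpha> * ((n * n) * n ^ 4 * (n powr (c0 * ln 4) * n powr (4 / umin)))"
    proof (intro mult_left_mono mult_right_mono)
      have "0 \<le> mix_const" unfolding mix_const_def using L_pos by (intro mult_nonneg_nonneg) auto
      then show "real k * mix_const \<le> n * n" using N kN by (intro mult_mono) (auto simp: n_def)
    qed (use kN \<alpha> in auto)
    also have "\<dots> = real k * n / \<alpha> * n powr (6 + 4 / umin + c0 * ln 4)"
    proof -
      have "(n * n) * n ^ 4 = n powr 6" using kN by (simp add: eval_nat_numeral)
      then show ?thesis by (simp add: powr_add)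
    qed
    \<comment> \<open>Since \<open>ln 3 \<le> ln 4\<close>, the term
      \<open>4 * ln 4 - 3 * ln 3\<close> is at least the \<open>ln 4\<close> that stems from
      \<open>4 powr q\<close>.\<close>
    also have "\<dots> \<le> real k * n / \<alpha> * n powr (c0 * (2 * L + 4 * ln 4 - 3 * ln 3))"
    proof (intro mult_left_mono powr_mono)
      have "ln 3 \<le> ln (4 :: real)" by simp
      then have "c0 * (2 * L) + c0 * ln 4 \<le> c0 * (2 * L + 4 * ln 4 - 3 * ln 3)"
        unfolding distrib_left [symmetric] using c_pos by (intro mult_left_mono) auto
      then show "6 + 4 / umin + c0 * ln 4 \<le> c0 * (2 * L + 4 * ln 4 - 3 * ln 3)"
        using c_L_ge by linarith
    qed (use kN \<alpha> in auto)
    \<comment> \<open>The prefactor \<open>80 * (c0 * ln n) ^ 4\<close> is at least 1, so it can be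
      inserted for free.\<close>
    also have "real k * n / \<alpha> * n powr (c0 * (2 * L + 4 * ln 4 - 3 * ln 3)) \<le>
      (80 * (c0 * ln n) ^ 4) * (real k * n / \<alpha> * n powr (c0 * (2 * L + 4 * ln 4 - 3 * ln 3)))"
    proof -
      let ?X = "real k * n / \<alpha> * n powr (c0 * (2 * L + 4 * ln 4 - 3 * ln 3))"
      have "1 \<le> (c0 * ln n) ^ 4" using N by (intro one_le_power) (simp add: n_def)
      then have "1 \<le> 80 * (c0 * ln n) ^ 4" by simp
      moreover have "0 \<le> ?X" using kN \<alpha> by (intro mult_nonneg_nonneg divide_nonneg_pos) auto
      ultimately have "1 * ?X \<le> (80 * (c0 * ln n) ^ 4) * ?X" by (rule mult_right_mono)
      then show ?thesis by (simp only: mult_1_left)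
    qed
    also have "\<dots> = 80 * real k * n * (1 / \<alpha>) * (c0 * ln n) ^ 4 * n powr (c0 * (2 * L + 4 * ln 4 - 3 * ln 3))"
      by simp
    finally show ?thesis by (simp add: n_def)
  qed
  finally show ?thesis by (simp add: L_def)
qed

text \<open>The event \<open>good_scale N\<close> does not depend on \<open>k\<close>, so its
  probability bounds all \<open>prob (B N k)\<close> from below at once, and the infimum is squeezed
  against 1.\<close>

lemma inf_prob_tendsto_1:
  defines "B \<equiv> \<lambda>N k. {a \<in> space M. t_mix (\<lambda>x. \<omega> x a) N k \<le>
      ereal (80 * real k * real N * (1 / \<alpha>) * (c0 * ln (real N)) ^ 4 *
        real N powr (c0 * (2 * ln ((1 - \<alpha>) / \<alpha>) + 4 * ln 4 - 3 * ln 3)))}"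
  shows "(\<lambda>N::nat. INF k\<in>{k::nat. 1 \<le> k \<and> real k \<le> real N / 2}. prob (B N k)) \<longlonglongrightarrow> 1"
proof (rule tendsto_sandwich)
  let ?K = "\<lambda>N::nat. {k::nat. 1 \<le> k \<and> real k \<le> real N / 2}"
  \<comment> \<open>For \<open>N < 2\<close> there is no admissible \<open>k\<close> and the infimum
    over the empty set carries no information.\<close>
  have ne: "?K N \<noteq> {}" if "2 \<le> N" for N using that by (auto intro!: exI [of _ 1])
  have "filterlim (\<lambda>N. c0 * ln (real N)) at_top sequentially"
    by (intro filterlim_tendsto_pos_mult_at_top [OF tendsto_const c_pos]
      filterlim_compose [OF ln_at_top filterlim_real_sequentially])
  then have e1: "\<forall>\<^sub>F N in sequentially. 1 \<le> c0 * ln (real N)" by (simp add: filterlim_at_top)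
  have e2: "\<forall>\<^sub>F N in sequentially. mix_const \<le> real N"
    using filterlim_real_sequentially by (simp add: filterlim_at_top)
  show "\<forall>\<^sub>F N in sequentially. 1 - (real N powr (- 1 / 3) / (1 - \<phi>) + real N powr (- umin)) \<le>
      (INF k\<in>?K N. prob (B N k))"
    using e1 e2 eventually_ge_at_top [of 2]
  proof eventually_elim
    case (elim N)
    show ?case
    proof (rule cINF_greatest [OF ne [OF elim(3)]])
      fix k assume k: "k \<in> ?K N"
      have "prob (good_scale N) \<le> prob (B N k)"
      proof (rule finite_measure_mono)
        show "good_scale N \<subseteq> B N k"
          using t_mix_good_scale [OF _ _ _ elim(1,2)] k
          by (auto simp: B_def good_scale_def good_def)
        \<comment> \<open>The measure of a nonmeasurable set is 0 by convention, so monotonicity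
          depends on this.\<close>
        show "B N k \<in> events"
          unfolding B_def using k by (intro sets_t_mix_le measurable_omega) auto
      qed
      then show "1 - (real N powr (- 1 / 3) / (1 - \<phi>) + real N powr (- umin)) \<le> prob (B N k)"
        using prob_good_scale [of N] elim(3) by simp
    qed
  qed
  show "\<forall>\<^sub>F N in sequentially. (INF k\<in>?K N. prob (B N k)) \<le> 1"
    using eventually_ge_at_top [of 2]
  proof eventually_elim
    case (elim N)
    then have "(INF k\<in>?K N. prob (B N k)) \<le> prob (B N 1)"
      by (intro cINF_lower) (auto intro!: bdd_belowI [of _ 0])
    then show ?case using prob_le_1 by (rule order_trans)
  qed
  have "(\<lambda>N. 1 - (real N powr (- 1 / 3) / (1 - \<phi>) + real N powr (- umin))) \<longlonglongrightarrow> 1 - (0 / (1 - \<phi>) + 0)"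
    using \<phi> u0_pos by (intro tendsto_intros tendsto_neg_powr filterlim_real_sequentially) auto
  then show "(\<lambda>N. 1 - (real N powr (- 1 / 3) / (1 - \<phi>) + real N powr (- umin))) \<longlonglongrightarrow> 1" by simp
qed simp

end

theorem theorem2p4:
  fixes M :: "'a measure" and \<omega> :: "int \<Rightarrow> 'a \<Rightarrow> real" and \<alpha> :: real
  assumes "prob_space M"
    and "prob_space.iid_environment M \<omega>"
    and "0 < \<alpha>" and "\<alpha> < 1 / 2"
    and "measure M {a \<in> space M. \<omega> 1 a \<in> {\<alpha>..1 - \<alpha>}} = 1"
    and "(LINT a|M. ln (rho (\<omega> 1 a))) < 0"
    and "prob_space.lambda_env M \<omega> < \<infinity>"
  defines "u\<^sub>0 \<equiv> prob_space.u0_env M \<omega>"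
  defines "c \<equiv> (3 * u\<^sub>0 + 2) / \<bar>prob_space.F_env M \<omega> u\<^sub>0\<bar>"
  defines "B \<equiv> \<lambda>N k. {a \<in> space M. t_mix (\<lambda>x. \<omega> x a) N k \<le>
      ereal (80 * real k * real N * (1 / \<alpha>) * (c * ln (real N)) ^ 4 *
        real N powr (c * (2 * ln ((1 - \<alpha>) / \<alpha>) + 4 * ln 4 - 3 * ln 3)))}"
  shows "(\<lambda>N::nat. INF k\<in>{k::nat. 1 \<le> k \<and> real k \<le> real N / 2}. measure M (B N k)) \<longlonglongrightarrow> 1"
proof -
  interpret random_environment M \<omega> \<alpha>
    using assms(1-7) by (auto simp: random_environment_def random_environment_axioms_def)
  show ?thesis
    using inf_prob_tendsto_1 unfolding B_def c_def u\<^sub>0_def c0_def umin_def .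
qed

end
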